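(* Let $\gamma\in(0,1)$, let $\mathbb{X}\subset\mathbb{R}^{d_{\mathbb{X}}}$ be nonempty and compact, and let $\mathbb{A}$ be either (case (i)) a nonempty compact subset of $\mathbb{R}^{d_{\mathbb{A}}}$, or (case (ii)) a finite set $\{a_1,\dots,a_m\}$. Put $\mathbb{Z}=\mathbb{X}\times\mathbb{A}$. Let $\mu_b$ be a probability measure on $\mathbb{Z}$, let $Q^*$ be the unique fixed point of $\bar{\mathcal{T}}$ in $C(\mathbb{Z})$, and let $q^*$ be the unique fixed point of $\mathcal{K}_{\mu_b}\circ\bar{\mathcal{T}}$ in $C(\mathbb{Z})$, where the kernel is $\kappa_\sigma$. Assume $Q^*$ is $\alpha$-Hölder in $\mathsf{d}$ for some $\alpha\in(0,1]$, i.e. there is $L_Q<\infty$ with $|Q^*(z)-Q^*(u)|\le L_Q\,\mathsf{d}(z,u)^\alpha$ for all $z,u\in\mathbb{Z}$. Then for every $\sigma>0$, $$\|Q^*-q^*\|\le\frac{L_Q}{1-\gamma}\,\xi_{\mu_b}(\sigma),\qquad \xi_{\mu_b}(\sigma):=\sup_{z\in\mathbb{Z}}\frac{\int_{\mathbb{Z}}\mathsf{d}(z,u)^\alpha\kappa_\sigma(z,u)\mu_b(du)}{\int_{\mathbb{Z}}\kappa_\sigma(z,u)\mu_b(du)}.$$ Assume in addition: - $\mu_b\ll\lambda$, with density $p_b=d\mu_b/d\lambda$ satisfying $0<\underline{p}_b=\operatorname{ess\,inf}_\lambda p_b\le\overline{p}_b=\operatorname{ess\,sup}_\lambda p_b<\infty$;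 - there are constants $0<v_\wedge\le1$ and $\sigma_\vee>0$ such that, for all $z=(x,a)\in\mathbb{Z}$: - in case (i), $\mathrm{Leb}(\{u\in\mathbb{Z}:|z-u|\le r\})\ge v_\wedge V_{d_{\mathbb{X}}+d_{\mathbb{A}}}(r)$ for all $r\in(0,\sigma_\vee\sqrt{d_{\mathbb{X}}+d_{\mathbb{A}}}]$; - in case (ii), $\mathrm{Leb}(\{y\in\mathbb{X}:|x-y|\le r\})\ge v_\wedge V_{d_{\mathbb{X}}}(r)$ for all $r\in(0,\sigma_\vee\sqrt{d_{\mathbb{X}}}]$. Then for all $\sigma\in(0,\sigma_\vee]$: - in case (i), $\xi_{\mu_b}(\sigma)\le\frac{2}{v_\wedge}\frac{\overline{p}_b}{\underline{p}_b}(d_{\mathbb{X}}+d_{\mathbb{A}})^{\alpha/2}\sigma^\alpha$; - in case (ii), $\xi_{\mu_b}(\sigma)\le\frac{2}{v_\wedge}\frac{\overline{p}_b}{\underline{p}_b}\big(d_{\mathbb{X}}^{\alpha/2}\sigma^\alpha+(m-1)(\mathrm{diam}(\mathbb{X})+1)^\alpha e^{-1/(2\sigma^2)}\big)$.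
   Context: Notation. $C(\mathbb{Z})$ is the space of continuous real functions on $\mathbb{Z}$ with the sup norm $\|\cdot\|$, and $|\cdot|$ is the Euclidean norm. Kernel. In case (i), $\kappa_\sigma(z,u)=\exp(-|z-u|^2/(2\sigma^2))$. In case (ii), for $z=(x,a_i)$ and $u=(y,a_j)$, $\kappa_\sigma(z,u)=\exp(-(|x-y|^2+\mathbf{1}_{i\ne j})/(2\sigma^2))$. For a probability measure $\mu$, $\mathcal{K}_\mu[q](z)=\int\kappa_\sigma(z,u)q(u)\mu(du)/\int\kappa_\sigma(z,u)\mu(du)$. Metric $\mathsf{d}$. In case (i), $\mathsf{d}(z,u)=|z-u|$. In case (ii), $\mathsf{d}((x,a_i),(y,a_j))=\sqrt{|x-y|^2+\mathbf{1}_{i\ne j}}$. Reference measure $\lambda$. In case (i), $\lambda$ is Lebesgue measure on $\mathbb{Z}\subset\mathbb{R}^{d_{\mathbb{X}}+d_{\mathbb{A}}}$. In case (ii), $\lambda$ is Lebesgue measure times counting measure on $\mathbb{X}\times\mathbb{A}$. Ball volume. $V_d(r)=\pi^{d/2}r^d/\Gamma(d/2+1)$ is the volume of a Euclidean ball of radius $r$ in $\mathbb{R}^d$. Bellman operator. $P(\cdot\mid x,a)$ is a transition kernel on $\mathbb{X}$ of the form $P(B\mid z)=\psi(\{w:f(z,w)\in B\})$, where $f:\mathbb{Z}\times\mathbb{W}\to\mathbb{X}$ is continuous and $\psi$ is a probability measure on a Borel set $\mathbb{W}\subset\mathbb{R}^{d_{\mathbb{W}}}$. The function $r\in C(\mathbb{Z})$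 satisfies $\|r\|\le1$. The clipping map is $\Pi(y)=\max\{\min\{y,1/(1-\gamma)\},-1/(1-\gamma)\}$, and $\bar{\mathcal{T}}[Q](x,a)=r(x,a)+\gamma\int_{\mathbb{X}}\max_{a'\in\mathbb{A}}\Pi(Q(x',a'))\,P(dx'\mid x,a)$. $\bar{\mathcal{T}}$ maps $C(\mathbb{Z})$ to itself and is a $\gamma$-contraction. *)

theory Defs
  imports "HOL-Probability.Probability"
begin

definition clip :: "real \<Rightarrow> real \<Rightarrow> real" where
  "clip \<gamma> y = max (min y (1 / (1 - \<gamma>))) (- (1 / (1 - \<gamma>)))"

text \<open>Bellman operator with P(B | z) = psi {w. f(z,w) in B}:
  Tbar[Q](z) = r(z) + gamma * integral over W of max over a' in A of Pi(Q(f(z,w),a')) d psi(w).\<close>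
definition bellman ::
  "real \<Rightarrow> ('x \<times> 'b \<Rightarrow> real) \<Rightarrow> (('x \<times> 'b) \<times> 'w \<Rightarrow> 'x) \<Rightarrow> 'w measure \<Rightarrow> 'b set
   \<Rightarrow> ('x \<times> 'b \<Rightarrow> real) \<Rightarrow> 'x \<times> 'b \<Rightarrow> real" where
  "bellman \<gamma> r f \<psi> A Q z =
     r z + \<gamma> * (\<integral>w. (SUP a'\<in>A. clip \<gamma> (Q (f (z, w), a'))) \<partial>\<psi>)"

text \<open>Gaussian kernel built from a metric d: exp(-d(z,u)^2/(2 sigma^2)).
  For case (i) d = Euclidean distance; for case (ii) d^2 = |x-y|^2 + [i /= j].\<close>
definition kern :: "('z \<Rightarrow> 'z \<Rightarrow> real) \<Rightarrow> real \<Rightarrow> 'z \<Rightarrow> 'z \<Rightarrow> real" where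
  "kern d \<sigma> z u = exp (- ((d z u)\<^sup>2) / (2 * \<sigma>\<^sup>2))"

definition kavg :: "('z \<Rightarrow> 'z \<Rightarrow> real) \<Rightarrow> 'z measure \<Rightarrow> ('z \<Rightarrow> real) \<Rightarrow> 'z \<Rightarrow> real" where
  "kavg \<kappa> \<mu> q z = (\<integral>u. \<kappa> z u * q u \<partial>\<mu>) / (\<integral>u. \<kappa> z u \<partial>\<mu>)"

definition dmix :: "'x::real_normed_vector \<times> 'b \<Rightarrow> 'x \<times> 'b \<Rightarrow> real" where
  "dmix z u = sqrt ((norm (fst z - fst u))\<^sup>2 + (if snd z = snd u then 0 else 1))"

definition xi :: "('z \<Rightarrow> 'z \<Rightarrow> real) \<Rightarrow> real \<Rightarrow> real \<Rightarrow> 'z measure \<Rightarrow> 'z set \<Rightarrow> real" where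
  "xi d \<alpha> \<sigma> \<mu> Z = (SUP z\<in>Z. (\<integral>u. d z u powr \<alpha> * kern d \<sigma> z u \<partial>\<mu>) / (\<integral>u. kern d \<sigma> z u \<partial>\<mu>))"

definition ball_vol :: "nat \<Rightarrow> real \<Rightarrow> real" where
  "ball_vol d r = pi powr (real d / 2) * r ^ d / Gamma (real d / 2 + 1)"

definition essinf :: "'a measure \<Rightarrow> ('a \<Rightarrow> ereal) \<Rightarrow> ereal" where
  "essinf M f = - esssup M (\<lambda>x. - f x)"

end

theory Submission
  imports Defs "HOL-Real_Asymp.Real_Asymp"
begin

text \<open>
  Write \<open>K\<close> for the kernel average and \<open>S\<close> for the sup distance of the two fixed points. Then
  \<open>Q - q = (Q - K Q) + K (T Q - T q)\<close>; the first term is controlled by the Hoelder condition and the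
  second is at most \<open>\<gamma> S\<close>, so \<open>(1 - \<gamma>) S \<le> L \<xi>\<close>.

  For the rate, let \<open>D\<close> be the dimension and \<open>R = \<sigma> \<surd>D\<close>, the root mean square radius of the
  Gaussian. The numerator of \<open>\<xi>\<close> is enlarged to all of space, where Jensen's inequality bounds the
  \<open>\<alpha>\<close>-th moment by \<open>R powr \<alpha>\<close> times the Gaussian mass. By the layer cake formula, the volume condition
  bounds the denominator from below by \<open>v\<close> times the Gaussian mass of the ball of radius \<open>R\<close>, which is at
  least half of the total mass because the median of the radius does not exceed \<open>R\<close>. With finitely many
  actions, every other action contributes a further factor \<open>exp (- 1 / (2 \<sigma>\<^sup>2))\<close> to the numerator.
\<close>

section \<open>Gaussian integrals over Euclidean space\<close>

text \<open>The image of Lebesgue measure under \<open>dist z\<close> and the weighted measure on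
  the half-line agree on every \<open>{..a}\<close>: both give the volume of a ball of radius
  \<open>a\<close>, because the weight is the derivative of that volume. These half-lines form an
  intersection-stable generator, so the two measures coincide.\<close>

lemma nn_integral_dist_polar:
  fixes z :: "'a::euclidean_space" and f :: "real \<Rightarrow> ennreal"
  assumes [measurable]: "f \<in> borel_measurable borel"
  shows "(\<integral>\<^sup>+u. f (dist z u) \<partial>lborel) =
    (\<integral>\<^sup>+s. ennreal (DIM('a) * unit_ball_vol DIM('a) * s ^ (DIM('a) - 1)) * indicator {0..} s * f s \<partial>lborel)"
proof -
  let ?D = "DIM('a)"
  let ?w = "\<lambda>s. ennreal (?D * unit_ball_vol ?D * s ^ (?D - 1)) * indicator {0..} s"
  have "distr lborel borel (dist z) = density lborel ?w"
  proof (rule measure_eqI_generator_eq[where E = "range (\<lambda>a. {..a})" and \<Omega> = UNIV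
        and A = "\<lambda>i. {..real i}"])
    show "Int_stable (range (\<lambda>a::real. {..a}))"
      by (auto simp: Int_stable_def)
    show "sets (distr lborel borel (dist z)) = sigma_sets UNIV (range (\<lambda>a. {..a}))"
         "sets (density lborel ?w) = sigma_sets UNIV (range (\<lambda>a. {..a}))"
      by (simp_all add: borel_eq_atMost)
    show "(\<Union>i. {..real i}) = UNIV"
      by (auto simp: real_arch_simple)
    have ball: "emeasure (distr lborel borel (dist z)) {..a} = emeasure lborel (cball z a)" for a
      by (simp add: emeasure_distr vimage_def cball_def)
    show "emeasure (distr lborel borel (dist z)) {..real i} \<noteq> \<infinity>" for i
      using emeasure_lborel_cball_finite[of z "real i"] by (simp add: ball)
    fix Y assume "Y \<in> range (\<lambda>a::real. {..a})"
    then obtain a where Y: "Y = {..a}" by auto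
    show "emeasure (distr lborel borel (dist z)) Y = emeasure (density lborel ?w) Y"
    proof (cases "0 \<le> a")
      case True
      have "emeasure (density lborel ?w) Y =
          (\<integral>\<^sup>+s. ennreal (?D * unit_ball_vol ?D * s ^ (?D - 1)) * indicator {0..a} s \<partial>lborel)"
        unfolding Y
        by (subst emeasure_density) (auto intro!: nn_integral_cong split: split_indicator)
      also have "\<dots> = ennreal (unit_ball_vol ?D * a ^ ?D - unit_ball_vol ?D * 0 ^ ?D)"
        by (rule nn_integral_FTC_Icc)
           (use True in \<open>auto intro!: derivative_eq_intros mult_nonneg_nonneg\<close>)
      also have "\<dots> = emeasure (distr lborel borel (dist z)) Y"
        using True by (simp add: Y ball emeasure_cball)
      finally show ?thesis ..
    next
      case False
      then have "emeasure (density lborel ?w) Y = 0"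
        unfolding Y by (subst emeasure_density) (auto intro!: nn_integral_zero' simp: indicator_def)
      then show ?thesis using False by (simp add: Y ball)
    qed
  qed auto
  then have "(\<integral>\<^sup>+s. f s \<partial>distr lborel borel (dist z)) = (\<integral>\<^sup>+s. f s \<partial>density lborel ?w)"
    by simp
  then show ?thesis
    by (simp add: nn_integral_distr nn_integral_density)
qed

text \<open>This is the integration by parts identity for Gaussian moments, read off here from the
  closed forms for even and odd exponents. Leaving \<open>m\<close> unspecified lets later arguments
  ignore the parity of the dimension.\<close>

lemma half_line_gaussian_moment_exists:
  "\<exists>m>0. has_bochner_integral lborel (\<lambda>x::real. indicator {0..} x *\<^sub>R (exp (- x\<^sup>2) * x ^ n)) m \<and>
         has_bochner_integral lborel (\<lambda>x::real. indicator {0..} x *\<^sub>R (exp (- x\<^sup>2) * x ^ (n + 2)))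
           ((real n + 1) / 2 * m)"
proof (cases "even n")
  case True
  then obtain k where n: "n = 2 * k" by auto
  let ?m = "sqrt pi / 2 * (fact (2 * k) / (2 ^ (2 * k) * fact k)) :: real"
  have "?m > 0" by simp
  \<comment> \<open>Passing from \<open>k\<close> to \<open>Suc k\<close> multiplies the closed form
    by \<open>(2 * k + 1) * (2 * k + 2) / (4 * (k + 1))\<close>, that is by
    \<open>(n + 1) / 2\<close>.\<close>
  moreover have "sqrt pi / 2 * (fact (2 * Suc k) / (2 ^ (2 * Suc k) * fact (Suc k))) = (real n + 1) / 2 * ?m"
  proof -
    have f1: "fact (2 * Suc k) = (2 * real k + 2) * ((2 * real k + 1) * fact (2 * k) :: real)"
      by (simp add: algebra_simps)
    have f2: "(2::real) ^ (2 * Suc k) * fact (Suc k) = (2 * real k + 2) * (2 * (2 ^ (2 * k) * fact k))"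
      by (simp add: algebra_simps)
    have "fact (2 * Suc k) / (2 ^ (2 * Suc k) * fact (Suc k))
        = (2 * real k + 1) * fact (2 * k) / (2 * (2 ^ (2 * k) * fact k) :: real)"
      unfolding f1 f2 by (rule mult_divide_mult_cancel_left) simp
    then show ?thesis by (simp only: n) simp
  qed
  ultimately show ?thesis
    using gaussian_moment_even_pos[of k] gaussian_moment_even_pos[of "Suc k"] unfolding n
    by (intro exI[of _ ?m]) simp
next
  case False
  then obtain k where n: "n = 2 * k + 1" by (auto elim: oddE)
  let ?m = "fact k / 2 :: real"
  have eq: "(2 + 2 * real k) * fact k / 4 = (1 + real k) * fact k / 2" by (simp add: field_simps)
  show ?thesis
    using gaussian_moment_odd_pos[of k] gaussian_moment_odd_pos[of "Suc k"] unfolding n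
    by (intro exI[of _ ?m]) (simp add: eq)
qed

text \<open>The substitution \<open>s = sqrt 2 * \<sigma> * x\<close> reduces both integrals to the
  unscaled moments. Their ratio is the mean square radius of the Gaussian in dimension
  \<open>n + 1\<close>, which is the origin of \<open>R\<close> below.\<close>

lemma nn_integral_half_line_gaussian:
  fixes \<sigma> :: real
  assumes "0 < \<sigma>"
  obtains m where "0 < m"
    "(\<integral>\<^sup>+s. ennreal (s ^ n * exp (- s\<^sup>2 / (2 * \<sigma>\<^sup>2))) * indicator {0..} s \<partial>lborel) = ennreal m"
    "(\<integral>\<^sup>+s. ennreal (s ^ (n + 2) * exp (- s\<^sup>2 / (2 * \<sigma>\<^sup>2))) * indicator {0..} s \<partial>lborel)
      = ennreal ((real n + 1) * \<sigma>\<^sup>2 * m)"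
proof -
  obtain m where m: "0 < m"
    "has_bochner_integral lborel (\<lambda>x::real. indicator {0..} x *\<^sub>R (exp (- x\<^sup>2) * x ^ n)) m"
    "has_bochner_integral lborel (\<lambda>x::real. indicator {0..} x *\<^sub>R (exp (- x\<^sup>2) * x ^ (n + 2))) ((real n + 1) / 2 * m)"
    by (rule exE[OF half_line_gaussian_moment_exists[of n]]) (elim conjE, rule that)
  define c where "c = sqrt 2 * \<sigma>"
  have c: "0 < c" "c\<^sup>2 = 2 * \<sigma>\<^sup>2" using assms by (auto simp: c_def power_mult_distrib)
  have scale: "(\<integral>\<^sup>+s. ennreal (s ^ k * exp (- s\<^sup>2 / (2 * \<sigma>\<^sup>2))) * indicator {0..} s \<partial>lborel) = ennreal (c ^ (k + 1) * I)"
    if I: "has_bochner_integral lborel (\<lambda>x::real. indicator {0..} x *\<^sub>R (exp (- x\<^sup>2) * x ^ k)) I" for k I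
  proof -
    have "(\<integral>\<^sup>+s. ennreal (s ^ k * exp (- s\<^sup>2 / (2 * \<sigma>\<^sup>2))) * indicator {0..} s \<partial>lborel)
        = ennreal c * (\<integral>\<^sup>+x. ennreal ((c * x) ^ k * exp (- (c * x)\<^sup>2 / (2 * \<sigma>\<^sup>2))) * indicator {0..} (c * x) \<partial>lborel)"
      using c by (subst nn_integral_real_affine[where c = c and t = 0]) simp_all
    also have "(\<integral>\<^sup>+x. ennreal ((c * x) ^ k * exp (- (c * x)\<^sup>2 / (2 * \<sigma>\<^sup>2))) * indicator {0..} (c * x) \<partial>lborel)
        = (\<integral>\<^sup>+x. ennreal (c ^ k) * ennreal (indicator {0..} x *\<^sub>R (exp (- x\<^sup>2) * x ^ k)) \<partial>lborel)"
    proof (intro nn_integral_cong)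
      fix x :: real
      have "0 \<le> c * x \<longleftrightarrow> 0 \<le> x" using c by (simp add: zero_le_mult_iff)
      then show "ennreal ((c * x) ^ k * exp (- (c * x)\<^sup>2 / (2 * \<sigma>\<^sup>2))) * indicator {0..} (c * x)
          = ennreal (c ^ k) * ennreal (indicator {0..} x *\<^sub>R (exp (- x\<^sup>2) * x ^ k))"
        using c assms by (auto simp: power_mult_distrib ennreal_mult'[symmetric] mult_ac split: split_indicator)
    qed
    also have "\<dots> = ennreal (c ^ k) * (\<integral>\<^sup>+x. ennreal (indicator {0..} x *\<^sub>R (exp (- x\<^sup>2) * x ^ k)) \<partial>lborel)"
      by (rule nn_integral_cmult) measurable
    also have "(\<integral>\<^sup>+x. ennreal (indicator {0..} x *\<^sub>R (exp (- x\<^sup>2) * x ^ k)) \<partial>lborel) = ennreal I"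
      using I by (subst nn_integral_eq_integral) (auto simp: has_bochner_integral_iff indicator_def)
    finally show ?thesis using c by (simp add: ennreal_mult' mult.assoc)
  qed
  show thesis
  proof (rule that[of "c ^ (n + 1) * m"])
    have "c ^ (n + 2 + 1) * ((real n + 1) / 2 * m) = c\<^sup>2 * c ^ (n + 1) * ((real n + 1) / 2 * m)"
      by (simp add: power_add power2_eq_square)
    also have "\<dots> = (real n + 1) * \<sigma>\<^sup>2 * (c ^ (n + 1) * m)"
      by (simp add: c(2))
    finally show "(\<integral>\<^sup>+s. ennreal (s ^ (n + 2) * exp (- s\<^sup>2 / (2 * \<sigma>\<^sup>2))) * indicator {0..} s \<partial>lborel)
      = ennreal ((real n + 1) * \<sigma>\<^sup>2 * (c ^ (n + 1) * m))"
      using scale[OF m(3)] by (simp only:)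
  qed (use m c scale[OF m(2)] in auto)
qed

section \<open>The median of the Gaussian radius\<close>

text \<open>Both sides vanish at 1, and their difference has the nonnegative derivative
  \<open>(1 - 1 / x)\<^sup>2\<close>.\<close>

lemma two_ln_le_diff_inverse:
  fixes w :: real
  assumes "1 \<le> w"
  shows "2 * ln w \<le> w - 1 / w"
proof -
  have "(\<lambda>w. w - 1 / w - 2 * ln w) 1 \<le> (\<lambda>w. w - 1 / w - 2 * ln w) w"
  proof (rule DERIV_nonneg_imp_nondecreasing[OF assms])
    fix x :: real assume "1 \<le> x"
    then have "((\<lambda>w. w - 1 / w - 2 * ln w) has_real_derivative (1 - 1 / x)\<^sup>2) (at x)"
      by (auto intro!: derivative_eq_intros simp: power2_eq_square field_simps)
    then show "\<exists>y. ((\<lambda>w. w - 1 / w - 2 * ln w) has_real_derivative y) (at x) \<and> 0 \<le> y"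
      by (intro exI[of _ "(1 - 1 / x)\<^sup>2"]) simp
  qed
  then show ?thesis by simp
qed

text \<open>Put \<open>s = R * x\<close>. Since
  \<open>R\<^sup>2 = (n + 1) * \<sigma>\<^sup>2\<close>, the quotient of the two sides is \<open>x ^
  (2 * (n + 1)) * exp (- (n + 1) / 2 * (x\<^sup>2 - 1 / x\<^sup>2))\<close>, and
  \<open>two_ln_le_diff_inverse\<close> at \<open>x\<^sup>2\<close> makes it at most 1. The factor
  \<open>R\<^sup>2 / s\<^sup>2\<close> is the Jacobian of the inversion.\<close>

lemma chi_density_reflect_le:
  fixes \<sigma> s :: real and n :: nat
  defines "g \<equiv> \<lambda>s::real. s ^ n * exp (- s\<^sup>2 / (2 * \<sigma>\<^sup>2))" and "R \<equiv> \<sigma> * sqrt (real (n + 1))"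
  assumes "0 < \<sigma>" "R \<le> s"
  shows "g s \<le> g (R\<^sup>2 / s) * (R\<^sup>2 / s\<^sup>2)"
proof -
  have R: "0 < R" using assms by (simp add: R_def)
  have R2: "R\<^sup>2 = \<sigma>\<^sup>2 * (n + 1)" by (simp add: R_def power_mult_distrib)
  define x where "x = s / R"
  have s: "s = R * x" using R by (simp add: x_def)
  have x: "1 \<le> x" using assms(4) R by (simp add: x_def)
  have e1: "s\<^sup>2 / (2 * \<sigma>\<^sup>2) = (n + 1) / 2 * x\<^sup>2"
    using assms(3) by (simp add: s power_mult_distrib R2 field_simps)
  have e2: "(R\<^sup>2 / s)\<^sup>2 / (2 * \<sigma>\<^sup>2) = (n + 1) / 2 * (1 / x\<^sup>2)"
  proof -
    have "(R\<^sup>2 / s)\<^sup>2 = R\<^sup>2 / x\<^sup>2" using R x by (simp add: s power2_eq_square field_simps)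
    then show ?thesis using assms(3) x by (simp only: R2) (simp add: field_simps)
  qed
  have "x ^ (2 * (n + 1)) = exp ((n + 1) * ln (x\<^sup>2))"
    using x by (simp only: exp_of_nat_mult power_mult) simp
  also have "\<dots> \<le> exp ((n + 1) / 2 * (x\<^sup>2 - 1 / x\<^sup>2))"
  proof -
    have "real (n + 1) / 2 * (2 * ln (x\<^sup>2)) \<le> real (n + 1) / 2 * (x\<^sup>2 - 1 / x\<^sup>2)"
      using two_ln_le_diff_inverse[of "x\<^sup>2"] x by (intro mult_left_mono) auto
    then show ?thesis by simp
  qed
  finally have *: "x ^ (2 * (n + 1)) * exp (- ((n + 1) / 2 * x\<^sup>2)) \<le> exp (- ((n + 1) / 2 * (1 / x\<^sup>2)))"
    by (simp only: right_diff_distrib exp_diff exp_minus) (simp add: divide_simps mult_ac)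
  have "g s = (R / x) ^ n / x\<^sup>2 * (x ^ (2 * (n + 1)) * exp (- ((n + 1) / 2 * x\<^sup>2)))"
    unfolding g_def minus_divide_left[symmetric] e1
    using x by (simp add: s power_mult_distrib power_divide power_add power_mult power2_eq_square)
  also have "\<dots> \<le> (R / x) ^ n / x\<^sup>2 * exp (- ((n + 1) / 2 * (1 / x\<^sup>2)))"
    using x R by (intro mult_left_mono *) auto
  also have "\<dots> = g (R\<^sup>2 / s) * (R\<^sup>2 / s\<^sup>2)"
    unfolding g_def minus_divide_left[symmetric] e2 using x R by (simp add: s power2_eq_square)
  finally show ?thesis .
qed


text \<open>The logarithm of the radius of a Gaussian vector has its mode at \<open>ln R\<close> and its density decays
  faster to the right than to the left of it, so \<open>s\<close> is compared with its inversion \<open>R\<^sup>2 / s\<close>.\<close>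
lemma chi_mass_le_twice_ball:
  fixes \<sigma> :: real and n :: nat
  defines "g \<equiv> \<lambda>s::real. s ^ n * exp (- s\<^sup>2 / (2 * \<sigma>\<^sup>2))" and "R \<equiv> \<sigma> * sqrt (real (n + 1))"
  assumes \<sigma>: "0 < \<sigma>"
  shows "(\<integral>\<^sup>+s. ennreal (g s) * indicator {0..} s \<partial>lborel)
       \<le> 2 * (\<integral>\<^sup>+s. ennreal (g s) * indicator {0..R} s \<partial>lborel)"
proof -
  have R: "0 < R" using \<sigma> by (simp add: R_def)
  have cont: "continuous_on S g" for S
    unfolding g_def using \<sigma> by (intro continuous_intros) auto
  have g_nonneg: "0 \<le> g s" if "0 \<le> s" for s
    using that by (simp add: g_def)
  have [measurable]: "g \<in> borel_measurable borel"
    by (rule borel_measurable_continuous_onI[OF cont])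
  define H where "H = (\<lambda>s. integral {0..s} g)"
  have H_nn: "(\<integral>\<^sup>+s. ennreal (g s) * indicator {0..b} s \<partial>lborel) = ennreal (H b)" for b
    unfolding H_def
    by (rule nn_integral_has_integral_lebesgue') (auto intro: g_nonneg integrable_integral integrable_continuous_real cont)
  have H_nonneg: "0 \<le> H b" for b
    unfolding H_def using g_nonneg by (intro integral_nonneg integrable_continuous_real cont) auto
  have H_deriv: "(H has_real_derivative g s) (at s)" if "0 < s" for s
  proof -
    have "(H has_real_derivative g s) (at s within {0..s + 1})"
      unfolding H_def using that by (intro integral_has_real_derivative cont) auto
    then show ?thesis
      using that by (simp add: at_within_Icc_at)
  qed
  have bound: "H b \<le> 2 * H R" if "R \<le> b" for b
  proof -
    \<comment> \<open>The inversion fixes \<open>R\<close>, so \<open>?F R\<close> is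
      \<open>- 2 * H R\<close>. By the reflection inequality \<open>?F\<close> is nondecreasing to
      the right of \<open>R\<close>, and dropping the nonnegative term
      \<open>H (R\<^sup>2 / b)\<close> leaves the bound.\<close>
    let ?F = "\<lambda>s. - H s - H (R\<^sup>2 / s)"
    have "?F R \<le> ?F b"
    proof (rule DERIV_nonneg_imp_nondecreasing[OF that])
      fix s assume "R \<le> s"
      then have s: "0 < s" using R by simp
      have "((\<lambda>s. H (R\<^sup>2 / s)) has_real_derivative g (R\<^sup>2 / s) * (- (R\<^sup>2 / s\<^sup>2))) (at s)"
        using s R by (intro DERIV_chain2[OF H_deriv])
          (auto intro!: derivative_eq_intros simp: power2_eq_square)
      then have "(?F has_real_derivative - g s - g (R\<^sup>2 / s) * (- (R\<^sup>2 / s\<^sup>2))) (at s)"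
        using H_deriv[OF s] by (intro derivative_intros)
      moreover have "g s \<le> g (R\<^sup>2 / s) * (R\<^sup>2 / s\<^sup>2)"
        using chi_density_reflect_le[OF \<sigma>, of n s] \<open>R \<le> s\<close> unfolding g_def R_def by simp
      ultimately show "\<exists>y. (?F has_real_derivative y) (at s) \<and> 0 \<le> y"
        by (intro exI[of _ "- g s - g (R\<^sup>2 / s) * (- (R\<^sup>2 / s\<^sup>2))"]) simp
    qed
    moreover have "R\<^sup>2 / R = R" using R by (simp add: power2_eq_square)
    ultimately show ?thesis using H_nonneg[of "R\<^sup>2 / b"] by simp
  qed
  \<comment> \<open>The right endpoints of the truncations start at \<open>R\<close>, so
    \<open>bound\<close> applies to each of them; monotone convergence carries it over to the
    half-line.\<close>
  have "(\<integral>\<^sup>+s. ennreal (g s) * indicator {0..} s \<partial>lborel)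
      = (\<integral>\<^sup>+s. (SUP i. ennreal (g s) * indicator {0..R + real i} s) \<partial>lborel)"
  proof (intro nn_integral_cong)
    fix s :: real
    obtain i where "s \<le> R + real i"
      using real_arch_simple[of "s - R"] by (auto simp: algebra_simps)
    then show "ennreal (g s) * indicator {0..} s = (SUP i. ennreal (g s) * indicator {0..R + real i} s)"
      by (intro antisym SUP_least) (auto intro!: SUP_upper2[of i] split: split_indicator)
  qed
  also have "\<dots> = (SUP i. \<integral>\<^sup>+s. ennreal (g s) * indicator {0..R + real i} s \<partial>lborel)"
    by (rule nn_integral_monotone_convergence_SUP)
       (auto simp: incseq_def le_fun_def split: split_indicator)
  also have "\<dots> \<le> ennreal (2 * H R)"
    by (auto intro!: SUP_least ennreal_leI bound simp: H_nn)
  also have "\<dots> = 2 * (\<integral>\<^sup>+s. ennreal (g s) * indicator {0..R} s \<partial>lborel)"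
    by (simp add: H_nn ennreal_mult')
  finally show ?thesis .
qed

section \<open>Mass, moment and ball estimates for the Gaussian\<close>

text \<open>The graph of a concave power lies below its tangent at 1. This is weighted AM-GM for
  \<open>t\<close> and 1, obtained from convexity of \<open>exp\<close> between \<open>ln t\<close>
  and 0. Integrating it gives the case of Jensen's inequality used for the moment.\<close>

lemma powr_le_interpolation:
  fixes t :: real
  assumes "0 \<le> t" "0 \<le> a" "a \<le> 1"
  shows "t powr a \<le> 1 + a * (t - 1)"
proof (cases "t = 0")
  case False
  then have "0 < t" using assms by simp
  have "t powr a = exp (a * ln t + (1 - a) * ln 1)"
    using \<open>0 < t\<close> by (simp add: powr_def)
  also have "\<dots> \<le> a * exp (ln t) + (1 - a) * exp (ln 1)"
    using convex_onD[OF exp_convex, of "1 - a" "ln t" 0] assms by (simp add: algebra_simps)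
  finally show ?thesis using \<open>0 < t\<close> by (simp add: algebra_simps)
qed (use assms in auto)

text \<open>Polar coordinates turn all claims into one-dimensional ones. The total mass
  \<open>T\<close> stays unspecified because it cancels in the quotient that defines
  \<open>xi\<close>.\<close>

lemma gaussian_integral_bounds:
  fixes \<sigma> \<alpha> :: real and z :: "'a::euclidean_space"
  defines "R \<equiv> \<sigma> * sqrt (real DIM('a))"
  assumes \<sigma>: "0 < \<sigma>" and \<alpha>: "0 < \<alpha>" "\<alpha> \<le> 1"
  obtains T where "0 < T"
    "(\<integral>\<^sup>+u. ennreal (exp (- (dist z u)\<^sup>2 / (2 * \<sigma>\<^sup>2))) \<partial>lborel) = ennreal T"
    "(\<integral>\<^sup>+u. ennreal (dist z u powr \<alpha> * exp (- (dist z u)\<^sup>2 / (2 * \<sigma>\<^sup>2))) \<partial>lborel) \<le> ennreal (R powr \<alpha> * T)"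
    "ennreal (T / 2) \<le> (\<integral>\<^sup>+u. ennreal (exp (- (dist z u)\<^sup>2 / (2 * \<sigma>\<^sup>2))) * indicator (cball z R) u \<partial>lborel)"
proof -
  define n where "n = DIM('a) - 1"
  have D: "DIM('a) = n + 1" using DIM_positive[where 'a='a] by (simp add: n_def)
  have R: "0 < R" "R\<^sup>2 = (real n + 1) * \<sigma>\<^sup>2"
    using \<sigma> by (auto simp: R_def D power_mult_distrib)
  define c where "c = real DIM('a) * unit_ball_vol DIM('a)"
  have c: "0 < c" by (simp add: c_def)
  have lin: "ennreal (p * x + q * y) = ennreal p * ennreal x + ennreal q * ennreal y"
    if "0 \<le> p" "0 \<le> x" "0 \<le> q" "0 \<le> y" for p x q y :: real
    using that by (simp add: ennreal_plus ennreal_mult')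
  let ?e = "\<lambda>s::real. exp (- s\<^sup>2 / (2 * \<sigma>\<^sup>2))"
  obtain m where m: "0 < m"
    "(\<integral>\<^sup>+s. ennreal (s ^ n * ?e s) * indicator {0..} s \<partial>lborel) = ennreal m"
    "(\<integral>\<^sup>+s. ennreal (s ^ (n + 2) * ?e s) * indicator {0..} s \<partial>lborel) = ennreal ((real n + 1) * \<sigma>\<^sup>2 * m)"
    using nn_integral_half_line_gaussian[OF \<sigma>, of n] .
  have polar: "(\<integral>\<^sup>+u. ennreal (h (dist z u)) \<partial>lborel) = ennreal c * (\<integral>\<^sup>+s. ennreal (s ^ n * h s) * indicator {0..} s \<partial>lborel)"
    if [measurable]: "h \<in> borel_measurable borel" for h
  proof -
    have "(\<integral>\<^sup>+u. ennreal (h (dist z u)) \<partial>lborel)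
      = (\<integral>\<^sup>+s. ennreal (c * s ^ n) * indicator {0..} s * ennreal (h s) \<partial>lborel)"
      using nn_integral_dist_polar[of "\<lambda>s. ennreal (h s)" z] by (simp add: c_def n_def)
    also have "\<dots> = (\<integral>\<^sup>+s. ennreal c * (ennreal (s ^ n * h s) * indicator {0..} s) \<partial>lborel)"
      using c by (intro nn_integral_cong) (auto simp: ennreal_mult' mult.assoc split: split_indicator)
    finally show ?thesis by (simp add: nn_integral_cmult)
  qed
  show thesis
  proof (rule that[of "c * m"])
    show "0 < c * m" using c m by simp
    show "(\<integral>\<^sup>+u. ennreal (?e (dist z u)) \<partial>lborel) = ennreal (c * m)"
      using polar[of ?e] c m by (simp add: ennreal_mult')
    have "(\<integral>\<^sup>+s. ennreal (s ^ n * (s powr \<alpha> * ?e s)) * indicator {0..} s \<partial>lborel)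
        \<le> (\<integral>\<^sup>+s. ennreal (R powr \<alpha> * (1 - \<alpha> / 2)) * (ennreal (s ^ n * ?e s) * indicator {0..} s)
             + ennreal (R powr \<alpha> * (\<alpha> / 2) / R\<^sup>2) * (ennreal (s ^ (n + 2) * ?e s) * indicator {0..} s) \<partial>lborel)"
    proof (intro nn_integral_mono)
      fix s :: real
      show "ennreal (s ^ n * (s powr \<alpha> * ?e s)) * indicator {0..} s
          \<le> ennreal (R powr \<alpha> * (1 - \<alpha> / 2)) * (ennreal (s ^ n * ?e s) * indicator {0..} s)
             + ennreal (R powr \<alpha> * (\<alpha> / 2) / R\<^sup>2) * (ennreal (s ^ (n + 2) * ?e s) * indicator {0..} s)"
      proof (cases "0 \<le> s")
        case True
        \<comment> \<open>The tangent bound is taken at \<open>s = R\<close>, in the variable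
          \<open>t = s\<^sup>2 / R\<^sup>2\<close> with exponent \<open>\<alpha> / 2\<close>. Using
          the square means that only the mass and the second moment occur after integration.\<close>
        have "s powr \<alpha> = R powr \<alpha> * ((s\<^sup>2 / R\<^sup>2) powr (\<alpha> / 2))"
          using True R(1) by (cases "s = 0")
            (simp_all add: powr_divide powr_powr flip: powr_numeral)
        also have "\<dots> \<le> R powr \<alpha> * (1 + \<alpha> / 2 * (s\<^sup>2 / R\<^sup>2 - 1))"
          using \<alpha> by (intro mult_left_mono powr_le_interpolation) auto
        finally have "s ^ n * ?e s * s powr \<alpha> \<le> s ^ n * ?e s * (R powr \<alpha> * (1 + \<alpha> / 2 * (s\<^sup>2 / R\<^sup>2 - 1)))"
          using True by (intro mult_left_mono) auto
        also have "\<dots> = R powr \<alpha> * (1 - \<alpha> / 2) * (s ^ n * ?e s) + R powr \<alpha> * (\<alpha> / 2) / R\<^sup>2 * (s ^ (n + 2) * ?e s)"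
          by (simp add: algebra_simps power_add power2_eq_square)
        finally have "s ^ n * (s powr \<alpha> * ?e s)
            \<le> R powr \<alpha> * (1 - \<alpha> / 2) * (s ^ n * ?e s) + R powr \<alpha> * (\<alpha> / 2) / R\<^sup>2 * (s ^ (n + 2) * ?e s)"
          by (simp only: mult_ac)
        then have "ennreal (s ^ n * (s powr \<alpha> * ?e s))
            \<le> ennreal (R powr \<alpha> * (1 - \<alpha> / 2) * (s ^ n * ?e s) + R powr \<alpha> * (\<alpha> / 2) / R\<^sup>2 * (s ^ (n + 2) * ?e s))"
          by (rule ennreal_leI)
        also have "\<dots> = ennreal (R powr \<alpha> * (1 - \<alpha> / 2)) * ennreal (s ^ n * ?e s)
              + ennreal (R powr \<alpha> * (\<alpha> / 2) / R\<^sup>2) * ennreal (s ^ (n + 2) * ?e s)"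
          using True \<alpha> by (intro lin) auto
        finally show ?thesis using True by simp
      qed simp
    qed
    also have "\<dots> = ennreal (R powr \<alpha> * (1 - \<alpha> / 2)) * ennreal m
        + ennreal (R powr \<alpha> * (\<alpha> / 2) / R\<^sup>2) * ennreal (R\<^sup>2 * m)"
      by (subst nn_integral_add, measurable, subst (1 2) nn_integral_cmult, measurable)
        (simp only: m R(2))
    also have "\<dots> = ennreal (R powr \<alpha> * (1 - \<alpha> / 2) * m + R powr \<alpha> * (\<alpha> / 2) / R\<^sup>2 * (R\<^sup>2 * m))"
      using \<alpha> m by (intro lin[symmetric]) auto
    \<comment> \<open>The second moment is exactly \<open>R\<^sup>2 * m\<close>, so the weights
      \<open>1 - \<alpha> / 2\<close> and \<open>\<alpha> / 2\<close> add up to 1.\<close>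
    also have "R powr \<alpha> * (1 - \<alpha> / 2) * m + R powr \<alpha> * (\<alpha> / 2) / R\<^sup>2 * (R\<^sup>2 * m) = R powr \<alpha> * m"
      using R(1) by (simp add: algebra_simps)
    finally have moment: "(\<integral>\<^sup>+s. ennreal (s ^ n * (s powr \<alpha> * ?e s)) * indicator {0..} s \<partial>lborel) \<le> ennreal (R powr \<alpha> * m)" .
    have "(\<integral>\<^sup>+u. ennreal (dist z u powr \<alpha> * ?e (dist z u)) \<partial>lborel)
        = ennreal c * (\<integral>\<^sup>+s. ennreal (s ^ n * (s powr \<alpha> * ?e s)) * indicator {0..} s \<partial>lborel)"
      by (rule polar) measurable
    also have "\<dots> \<le> ennreal c * ennreal (R powr \<alpha> * m)"
      by (intro mult_left_mono moment) simp
    also have "\<dots> = ennreal (R powr \<alpha> * (c * m))"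
      using c by (simp add: ennreal_mult'[symmetric] mult_ac)
    finally show "(\<integral>\<^sup>+u. ennreal (dist z u powr \<alpha> * ?e (dist z u)) \<partial>lborel) \<le> ennreal (R powr \<alpha> * (c * m))" .
    have "2 * ennreal (c * m / 2) = ennreal c * ennreal m"
      using c m by (simp add: ennreal_mult'[symmetric] flip: ennreal_numeral)
    also have "\<dots> \<le> ennreal c * (2 * (\<integral>\<^sup>+s. ennreal (s ^ n * ?e s) * indicator {0..R} s \<partial>lborel))"
      using chi_mass_le_twice_ball[OF \<sigma>, of n] unfolding m(2)[symmetric] R_def D by (intro mult_left_mono) auto
    \<comment> \<open>The cutoff becomes part of the radial function, so that \<open>polar\<close>
      can turn it into the indicator of the ball.\<close>
    also have "(\<integral>\<^sup>+s. ennreal (s ^ n * ?e s) * indicator {0..R} s \<partial>lborel)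
        = (\<integral>\<^sup>+s. ennreal (s ^ n * (?e s * indicator {..R} s)) * indicator {0..} s \<partial>lborel)"
      by (intro nn_integral_cong) (auto split: split_indicator)
    also have "ennreal c * (2 * \<dots>) = 2 * (ennreal c * \<dots>)"
      by (simp add: mult_ac)
    also have "ennreal c * (\<integral>\<^sup>+s. ennreal (s ^ n * (?e s * indicator {..R} s)) * indicator {0..} s \<partial>lborel)
        = (\<integral>\<^sup>+u. ennreal (?e (dist z u) * indicator {..R} (dist z u)) \<partial>lborel)"
      by (rule polar[symmetric]) measurable
    also have "\<dots> = (\<integral>\<^sup>+u. ennreal (?e (dist z u)) * indicator (cball z R) u \<partial>lborel)"
      by (intro nn_integral_cong) (auto split: split_indicator)
    finally show "ennreal (c * m / 2) \<le> (\<integral>\<^sup>+u. ennreal (?e (dist z u)) * indicator (cball z R) u \<partial>lborel)"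
      by (subst (asm) ennreal_mult_le_mult_iff) auto
  qed
qed

section \<open>The layer cake formula and thick sets\<close>

text \<open>The factor in front of the sublevel measure is minus the derivative of the Gaussian
  profile, so its integral over \<open>{b..}\<close> is the profile at \<open>b\<close>. Taking
  \<open>b = h u\<close> and exchanging the integrals gives the formula, through which a Gaussian
  integral depends only on the measures of balls.\<close>

lemma nn_integral_gaussian_layer_cake:
  fixes \<sigma> :: real and h :: "'a \<Rightarrow> real"
  assumes \<sigma>: "0 < \<sigma>" and "sigma_finite_measure N" and [measurable]: "h \<in> borel_measurable N"
    and nonneg: "\<And>u. u \<in> space N \<Longrightarrow> 0 \<le> h u"
  shows "(\<integral>\<^sup>+u. ennreal (exp (- (h u)\<^sup>2 / (2 * \<sigma>\<^sup>2))) \<partial>N)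
    = (\<integral>\<^sup>+s. ennreal (s / \<sigma>\<^sup>2 * exp (- s\<^sup>2 / (2 * \<sigma>\<^sup>2))) * indicator {0<..} s * emeasure N {u \<in> space N. h u \<le> s} \<partial>lborel)"
proof -
  interpret N: sigma_finite_measure N by fact
  interpret pair_sigma_finite N lborel ..
  let ?k = "\<lambda>s::real. s / \<sigma>\<^sup>2 * exp (- s\<^sup>2 / (2 * \<sigma>\<^sup>2))"
  have tail: "ennreal (exp (- b\<^sup>2 / (2 * \<sigma>\<^sup>2))) = (\<integral>\<^sup>+s. ennreal (?k s) * indicator {0<..} s * indicator {b..} s \<partial>lborel)"
    if "0 \<le> b" for b :: real
  proof -
    have "((\<lambda>s. - exp (- s\<^sup>2 / (2 * \<sigma>\<^sup>2))) \<longlongrightarrow> 0) at_top"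
      using \<sigma> by real_asymp
    then have "(\<integral>\<^sup>+s. ennreal (?k s) * indicator {b..} s \<partial>lborel) = ennreal (0 - - exp (- b\<^sup>2 / (2 * \<sigma>\<^sup>2)))"
      using \<sigma> that by (intro nn_integral_FTC_atLeast)
        (auto intro!: derivative_eq_intros simp: field_simps power2_eq_square)
    also have "(\<integral>\<^sup>+s. ennreal (?k s) * indicator {b..} s \<partial>lborel)
        = (\<integral>\<^sup>+s. ennreal (?k s) * indicator {0<..} s * indicator {b..} s \<partial>lborel)"
      using that by (intro nn_integral_cong) (auto split: split_indicator)
    finally show ?thesis by simp
  qed
  have "(\<integral>\<^sup>+u. ennreal (exp (- (h u)\<^sup>2 / (2 * \<sigma>\<^sup>2))) \<partial>N)
      = (\<integral>\<^sup>+u. \<integral>\<^sup>+s. ennreal (?k s) * indicator {0<..} s * indicator {h u..} s \<partial>lborel \<partial>N)"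
    using nonneg by (intro nn_integral_cong tail) auto
  also have "\<dots> = (\<integral>\<^sup>+s. \<integral>\<^sup>+u. ennreal (?k s) * indicator {0<..} s * indicator {h u..} s \<partial>N \<partial>lborel)"
    by (rule Fubini'[symmetric]) (simp add: indicator_def atLeast_def)
  also have "\<dots> = (\<integral>\<^sup>+s. ennreal (?k s) * indicator {0<..} s * emeasure N {u \<in> space N. h u \<le> s} \<partial>lborel)"
  proof (intro nn_integral_cong)
    fix s :: real
    have "(\<integral>\<^sup>+u. ennreal (?k s) * indicator {0<..} s * indicator {h u..} s \<partial>N)
        = (\<integral>\<^sup>+u. ennreal (?k s) * indicator {0<..} s * indicator {u \<in> space N. h u \<le> s} u \<partial>N)"
      by (intro nn_integral_cong) (auto split: split_indicator)
    then show "(\<integral>\<^sup>+u. ennreal (?k s) * indicator {0<..} s * indicator {h u..} s \<partial>N)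
        = ennreal (?k s) * indicator {0<..} s * emeasure N {u \<in> space N. h u \<le> s}"
      by (simp add: nn_integral_cmult_indicator)
  qed
  finally show ?thesis .
qed

lemma emeasure_cball_ball_vol:
  fixes z :: "'a::euclidean_space"
  shows "0 \<le> \<rho> \<Longrightarrow> emeasure lborel (cball z \<rho>) = ennreal (ball_vol DIM('a) \<rho>)"
  by (simp add: emeasure_cball ball_vol_def unit_ball_vol_def)

text \<open>The two layer cake integrals are compared level by level. For \<open>s \<le> R\<close>
  this is the thickness assumption. For larger \<open>s\<close> the set on the left stays equal to
  \<open>cball z R\<close>, so thickness at radius \<open>R\<close> and monotonicity
  suffice.\<close>

lemma gaussian_integral_thick_ge:
  fixes \<sigma> v R :: real and S :: "'a::euclidean_space set"
  assumes \<sigma>: "0 < \<sigma>" and R: "0 < R" and v: "0 < v" and S: "S \<in> sets borel"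
    and thick: "\<And>\<rho>. 0 < \<rho> \<Longrightarrow> \<rho> \<le> R \<Longrightarrow>
      ennreal (v * ball_vol DIM('a) \<rho>) \<le> emeasure lborel {u \<in> S. dist z u \<le> \<rho>}"
  shows "ennreal v * (\<integral>\<^sup>+u. ennreal (exp (- (dist z u)\<^sup>2 / (2 * \<sigma>\<^sup>2))) * indicator (cball z R) u \<partial>lborel)
    \<le> (\<integral>\<^sup>+u. ennreal (exp (- (dist z u)\<^sup>2 / (2 * \<sigma>\<^sup>2))) * indicator S u \<partial>lborel)"
proof -
  let ?k = "\<lambda>s::real. s / \<sigma>\<^sup>2 * exp (- s\<^sup>2 / (2 * \<sigma>\<^sup>2))"
  have cake: "(\<integral>\<^sup>+u. ennreal (exp (- (dist z u)\<^sup>2 / (2 * \<sigma>\<^sup>2))) * indicator B u \<partial>lborel)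
      = (\<integral>\<^sup>+s. ennreal (?k s) * indicator {0<..} s * emeasure lborel {u \<in> B. dist z u \<le> s} \<partial>lborel)"
    if B: "B \<in> sets borel" for B
  proof -
    have "(\<integral>\<^sup>+u. ennreal (exp (- (dist z u)\<^sup>2 / (2 * \<sigma>\<^sup>2))) * indicator B u \<partial>lborel)
        = (\<integral>\<^sup>+u. ennreal (exp (- (dist z u)\<^sup>2 / (2 * \<sigma>\<^sup>2))) \<partial>restrict_space lborel B)"
      using B by (simp add: nn_integral_restrict_space)
    also have "\<dots> = (\<integral>\<^sup>+s. ennreal (?k s) * indicator {0<..} s
        * emeasure (restrict_space lborel B) {u \<in> space (restrict_space lborel B). dist z u \<le> s} \<partial>lborel)"
      using B by (intro nn_integral_gaussian_layer_cake \<sigma> sigma_finite_measure_restrict_space lborel.sigma_finite_measure_axioms)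
        (auto intro: measurable_restrict_space1)
    also have "\<dots> = (\<integral>\<^sup>+s. ennreal (?k s) * indicator {0<..} s * emeasure lborel {u \<in> B. dist z u \<le> s} \<partial>lborel)"
      using B by (simp add: emeasure_restrict_space space_restrict_space)
    finally show ?thesis .
  qed
  have vol: "ennreal v * emeasure lborel {u \<in> cball z R. dist z u \<le> s} \<le> emeasure lborel {u \<in> S. dist z u \<le> s}"
    if "0 < s" for s
  proof -
    have "{u \<in> cball z R. dist z u \<le> s} = cball z (min s R)" by auto
    then have "ennreal v * emeasure lborel {u \<in> cball z R. dist z u \<le> s} = ennreal (v * ball_vol DIM('a) (min s R))"
      using that R v by (simp add: emeasure_cball_ball_vol ennreal_mult')
    also have "\<dots> \<le> emeasure lborel {u \<in> S. dist z u \<le> min s R}"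
      using that R by (intro thick) auto
    also have "\<dots> \<le> emeasure lborel {u \<in> S. dist z u \<le> s}"
      using S by (intro emeasure_mono) auto
    finally show ?thesis .
  qed
  \<comment> \<open>Moving \<open>v\<close> into the integral requires measurability in
    \<open>s\<close>, which the closed form supplies. The \<open>max 0\<close> covers negative
    \<open>s\<close>, where the set is empty and the volume for radius 0 is 0.\<close>
  have [measurable]: "(\<lambda>s. emeasure lborel {u \<in> cball z R. dist z u \<le> s}) \<in> borel_measurable borel"
  proof -
    have "emeasure lborel {u \<in> cball z R. dist z u \<le> s} = ennreal (ball_vol DIM('a) (max 0 (min s R)))" for s
    proof (cases "0 \<le> s")
      case True
      moreover have "{u \<in> cball z R. dist z u \<le> s} = cball z (min s R)" by auto
      ultimately show ?thesis
        using R by (simp add: emeasure_cball_ball_vol)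
    next
      case False
      then have "dist z u > s" for u
        by (meson not_le order_trans zero_le_dist)
      then have empty: "{u \<in> cball z R. dist z u \<le> s} = {}" by (auto simp: not_le)
      show ?thesis unfolding empty using False by (simp add: ball_vol_def)
    qed
    then show ?thesis by (simp add: ball_vol_def)
  qed
  have "ennreal v * (\<integral>\<^sup>+u. ennreal (exp (- (dist z u)\<^sup>2 / (2 * \<sigma>\<^sup>2))) * indicator (cball z R) u \<partial>lborel)
      = (\<integral>\<^sup>+s. ennreal v * (ennreal (?k s) * indicator {0<..} s * emeasure lborel {u \<in> cball z R. dist z u \<le> s}) \<partial>lborel)"
    by (subst cake) (auto simp: nn_integral_cmult)
  also have "\<dots> \<le> (\<integral>\<^sup>+s. ennreal (?k s) * indicator {0<..} s * emeasure lborel {u \<in> S. dist z u \<le> s} \<partial>lborel)"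
    using vol by (intro nn_integral_mono) (auto simp: mult.left_commute[of "ennreal v"] split: split_indicator intro!: mult_left_mono)
  also have "\<dots> = (\<integral>\<^sup>+u. ennreal (exp (- (dist z u)\<^sup>2 / (2 * \<sigma>\<^sup>2))) * indicator S u \<partial>lborel)"
    using S by (rule cake[symmetric])
  finally show ?thesis .
qed

section \<open>Bellman operator and kernel averages\<close>

lemma abs_cSUP_diff_le:
  fixes f g :: "'a \<Rightarrow> real"
  assumes "S \<noteq> {}" "bdd_above (f ` S)" "bdd_above (g ` S)" "\<And>x. x \<in> S \<Longrightarrow> \<bar>f x - g x\<bar> \<le> e"
  shows "\<bar>(SUP x\<in>S. f x) - (SUP x\<in>S. g x)\<bar> \<le> e"
proof -
  have "(SUP x\<in>S. f x) \<le> (SUP x\<in>S. g x) + e"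
  proof (rule cSUP_least[OF assms(1)])
    fix x assume "x \<in> S"
    then have "g x \<le> (SUP x\<in>S. g x)" by (intro cSUP_upper assms)
    then show "f x \<le> (SUP x\<in>S. g x) + e" using assms(4)[OF \<open>x \<in> S\<close>] by simp
  qed
  moreover have "(SUP x\<in>S. g x) \<le> (SUP x\<in>S. f x) + e"
  proof (rule cSUP_least[OF assms(1)])
    fix x assume "x \<in> S"
    then have "f x \<le> (SUP x\<in>S. f x)" by (intro cSUP_upper assms)
    then show "g x \<le> (SUP x\<in>S. f x) + e" using assms(4)[OF \<open>x \<in> S\<close>] by simp
  qed
  ultimately show ?thesis by simp
qed

lemma abs_cSUP_le:
  fixes f :: "'a \<Rightarrow> real"
  assumes "S \<noteq> {}" "\<And>x. x \<in> S \<Longrightarrow> \<bar>f x\<bar> \<le> C"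
  shows "\<bar>SUP x\<in>S. f x\<bar> \<le> C"
proof -
  have "bdd_above (f ` S)" using assms(2) by (intro bdd_aboveI2[of _ _ C]) (auto simp: abs_le_iff)
  then show ?thesis
    using abs_cSUP_diff_le[of S f "\<lambda>_. 0" C] assms by (simp add: image_constant_conv)
qed

lemma abs_clip_le: "\<gamma> < 1 \<Longrightarrow> \<bar>clip \<gamma> y\<bar> \<le> 1 / (1 - \<gamma>)"
  by (auto simp: clip_def max_def min_def)

lemma bdd_above_clip: "\<gamma> < 1 \<Longrightarrow> bdd_above ((\<lambda>a. clip \<gamma> (h a)) ` S)"
  using abs_clip_le by (intro bdd_aboveI2[of _ _ "1 / (1 - \<gamma>)"]) (auto simp: abs_le_iff)

lemma abs_clip_diff_le: "\<bar>clip \<gamma> x - clip \<gamma> y\<bar> \<le> \<bar>x - y\<bar>"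
proof -
  have "\<bar>max (min x c) (- c) - max (min y c) (- c)\<bar> \<le> \<bar>x - y\<bar>" for c :: real
    by linarith
  then show ?thesis by (simp add: clip_def)
qed

text \<open>Compactness of \<open>A\<close> makes the continuity of \<open>Q\<close> in the state
  uniform over the actions, and neither clipping nor the supremum increases a uniform distance. The
  bound \<open>e / 2\<close> leaves room for the supremum, which preserves only non-strict
  inequalities.\<close>

lemma continuous_on_SUP_clip:
  fixes Q :: "'x::metric_space \<times> 'b::topological_space \<Rightarrow> real"
  assumes "\<gamma> < 1" "compact A" "A \<noteq> {}" "continuous_on (X \<times> A) Q"
  shows "continuous_on X (\<lambda>x. SUP a\<in>A. clip \<gamma> (Q (x, a)))"
  unfolding continuous_on_iff
proof (intro ballI allI impI)
  fix x e assume x: "x \<in> X" and e: "(0::real) < e"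
  obtain U where U: "x \<in> U" "open U" "\<forall>y\<in>U \<inter> X. \<forall>a\<in>A. dist (Q (y, a)) (Q (x, a)) \<le> e / 2"
    using continuous_on_prod_compactE[OF assms(4,2) x half_gt_zero[OF e]] .
  obtain \<delta> where \<delta>: "0 < \<delta>" "\<And>y. dist y x < \<delta> \<Longrightarrow> y \<in> U"
    using U(1,2) unfolding open_dist by blast
  have "dist (SUP a\<in>A. clip \<gamma> (Q (y, a))) (SUP a\<in>A. clip \<gamma> (Q (x, a))) < e"
    if y: "y \<in> X" "dist y x < \<delta>" for y
  proof -
    have "\<bar>clip \<gamma> (Q (y, a)) - clip \<gamma> (Q (x, a))\<bar> \<le> e / 2" if "a \<in> A" for a
      using abs_clip_diff_le[of \<gamma> "Q (y, a)" "Q (x, a)"] U(3) \<delta>(2) that y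
      by (force simp: dist_real_def)
    then have "\<bar>(SUP a\<in>A. clip \<gamma> (Q (y, a))) - (SUP a\<in>A. clip \<gamma> (Q (x, a)))\<bar> \<le> e / 2"
      using assms by (intro abs_cSUP_diff_le bdd_above_clip) auto
    then show ?thesis using e by (simp add: dist_real_def)
  qed
  then show "\<exists>d>0. \<forall>y\<in>X. dist y x < d \<longrightarrow>
      dist (SUP a\<in>A. clip \<gamma> (Q (y, a))) (SUP a\<in>A. clip \<gamma> (Q (x, a))) < e"
    using \<delta>(1) by blast
qed

text \<open>Actions live in a general topological type so that one argument serves both cases: a
  finite set of naturals is compact in the discrete topology. First countability supports the
  sequential argument in \<open>continuous_on_bellman\<close>.\<close>

locale bellman_model =
  fixes \<gamma> :: real and X :: "'x::metric_space set" and A :: "'b::{first_countable_topology, t2_space} set"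
    and W :: "'w::topological_space set" and \<psi> :: "'w measure"
    and f :: "('x \<times> 'b) \<times> 'w \<Rightarrow> 'x" and r :: "'x \<times> 'b \<Rightarrow> real"
  assumes \<gamma>: "0 < \<gamma>" "\<gamma> < 1"
    and X: "compact X" "X \<noteq> {}" and A: "compact A" "A \<noteq> {}"
    and prob_\<psi>: "prob_space \<psi>" and sets_\<psi>: "sets \<psi> = sets (restrict_space borel W)"
    and f: "continuous_on ((X \<times> A) \<times> W) f" "\<And>z w. z \<in> X \<times> A \<Longrightarrow> w \<in> W \<Longrightarrow> f (z, w) \<in> X"
    and r: "continuous_on (X \<times> A) r"
begin

lemma space_\<psi>: "space \<psi> = W"
  using sets_eq_imp_space_eq[OF sets_\<psi>] by (simp add: space_restrict_space)

text \<open>Joint continuity is used in two ways: with the state-action pair fixed it gives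
  measurability in the noise, and with the noise fixed it gives pointwise convergence under the
  integral.\<close>

lemma continuous_on_next_value:
  assumes "continuous_on (X \<times> A) Q"
  shows "continuous_on ((X \<times> A) \<times> W) (\<lambda>y. SUP a\<in>A. clip \<gamma> (Q (f y, a)))"
  by (rule continuous_on_compose2[OF continuous_on_SUP_clip[OF \<gamma>(2) A assms] f(1)])
     (use f(2) in auto)

lemma measurable_next_value:
  assumes "continuous_on (X \<times> A) Q" "z \<in> X \<times> A"
  shows "(\<lambda>w. SUP a\<in>A. clip \<gamma> (Q (f (z, w), a))) \<in> borel_measurable \<psi>"
proof -
  have "continuous_on W (\<lambda>w. SUP a\<in>A. clip \<gamma> (Q (f (z, w), a)))"
    by (rule continuous_on_compose2[OF continuous_on_next_value[OF assms(1)], of _ "\<lambda>w. (z, w)"])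
       (use assms(2) in \<open>auto intro!: continuous_intros\<close>)
  then show ?thesis
    unfolding measurable_cong_sets[OF sets_\<psi> refl] by (rule borel_measurable_continuous_on_restrict)
qed

lemma abs_next_value_le: "\<bar>SUP a\<in>A. clip \<gamma> (Q (f y, a))\<bar> \<le> 1 / (1 - \<gamma>)"
  using A \<gamma> by (intro abs_cSUP_le abs_clip_le)

lemma integrable_next_value:
  assumes "continuous_on (X \<times> A) Q" "z \<in> X \<times> A"
  shows "integrable \<psi> (\<lambda>w. SUP a\<in>A. clip \<gamma> (Q (f (z, w), a)))"
proof -
  interpret prob_space \<psi> by (rule prob_\<psi>)
  show ?thesis
    by (rule integrable_const_bound[where B = "1 / (1 - \<gamma>)"])
       (use abs_next_value_le measurable_next_value[OF assms] in auto)
qed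

text \<open>Dominated convergence along sequences; clipping provides the constant dominating
  function \<open>1 / (1 - \<gamma>)\<close>.\<close>

lemma continuous_on_bellman:
  assumes "continuous_on (X \<times> A) Q"
  shows "continuous_on (X \<times> A) (bellman \<gamma> r f \<psi> A Q)"
proof -
  interpret prob_space \<psi> by (rule prob_\<psi>)
  have "continuous_on (X \<times> A) (\<lambda>z. \<integral>w. (SUP a\<in>A. clip \<gamma> (Q (f (z, w), a))) \<partial>\<psi>)"
    unfolding continuous_on_sequentially
  proof (intro allI ballI impI)
    fix s z assume z: "z \<in> X \<times> A" and s: "(\<forall>n. s n \<in> X \<times> A) \<and> s \<longlonglongrightarrow> z"
    have "(\<lambda>n. \<integral>w. (SUP a\<in>A. clip \<gamma> (Q (f (s n, w), a))) \<partial>\<psi>)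
        \<longlonglongrightarrow> (\<integral>w. (SUP a\<in>A. clip \<gamma> (Q (f (z, w), a))) \<partial>\<psi>)"
    proof (rule integral_dominated_convergence[where w = "\<lambda>_. 1 / (1 - \<gamma>)"])
      show "AE w in \<psi>. (\<lambda>n. SUP a\<in>A. clip \<gamma> (Q (f (s n, w), a))) \<longlonglongrightarrow> (SUP a\<in>A. clip \<gamma> (Q (f (z, w), a)))"
      proof (rule AE_I2)
        fix w assume "w \<in> space \<psi>"
        then have w: "w \<in> W" by (simp add: space_\<psi>)
        have "continuous_on (X \<times> A) (\<lambda>z. SUP a\<in>A. clip \<gamma> (Q (f (z, w), a)))"
          by (rule continuous_on_compose2[OF continuous_on_next_value[OF assms], of _ "\<lambda>z. (z, w)"])
             (use w in \<open>auto intro!: continuous_intros\<close>)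
        then show "(\<lambda>n. SUP a\<in>A. clip \<gamma> (Q (f (s n, w), a))) \<longlonglongrightarrow> (SUP a\<in>A. clip \<gamma> (Q (f (z, w), a)))"
          using z s unfolding continuous_on_sequentially comp_def by blast
      qed
    qed (use z s assms abs_next_value_le in \<open>auto intro: measurable_next_value\<close>)
    then show "((\<lambda>z. \<integral>w. (SUP a\<in>A. clip \<gamma> (Q (f (z, w), a))) \<partial>\<psi>) \<circ> s)
        \<longlonglongrightarrow> (\<integral>w. (SUP a\<in>A. clip \<gamma> (Q (f (z, w), a))) \<partial>\<psi>)"
      by (simp add: comp_def)
  qed
  then show ?thesis
    unfolding bellman_def[abs_def] by (intro continuous_intros r)
qed

text \<open>Clipping, the supremum over actions and averaging under \<open>\<psi>\<close> are all
  nonexpansive, and \<open>r\<close> cancels, so only the factor \<open>\<gamma>\<close>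
  remains.\<close>

lemma bellman_contraction:
  assumes Q: "continuous_on (X \<times> A) Q" and Q': "continuous_on (X \<times> A) Q'"
    and S: "\<And>z. z \<in> X \<times> A \<Longrightarrow> \<bar>Q z - Q' z\<bar> \<le> S" and z: "z \<in> X \<times> A"
  shows "\<bar>bellman \<gamma> r f \<psi> A Q z - bellman \<gamma> r f \<psi> A Q' z\<bar> \<le> \<gamma> * S"
proof -
  interpret prob_space \<psi> by (rule prob_\<psi>)
  let ?V = "\<lambda>Q w. SUP a\<in>A. clip \<gamma> (Q (f (z, w), a))"
  have le: "\<bar>?V Q w - ?V Q' w\<bar> \<le> S" if w: "w \<in> W" for w
  proof (intro abs_cSUP_diff_le bdd_above_clip \<gamma> A)
    fix a assume "a \<in> A"
    then show "\<bar>clip \<gamma> (Q (f (z, w), a)) - clip \<gamma> (Q' (f (z, w), a))\<bar> \<le> S"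
      using S[of "(f (z, w), a)"] abs_clip_diff_le[of \<gamma> "Q (f (z, w), a)" "Q' (f (z, w), a)"] f(2)[OF z w]
      by auto
  qed
  have "\<bar>(\<integral>w. ?V Q w \<partial>\<psi>) - (\<integral>w. ?V Q' w \<partial>\<psi>)\<bar> = \<bar>\<integral>w. ?V Q w - ?V Q' w \<partial>\<psi>\<bar>"
    using z Q Q' by (simp add: integrable_next_value)
  also have "\<dots> \<le> (\<integral>w. \<bar>?V Q w - ?V Q' w\<bar> \<partial>\<psi>)"
    by (rule integral_abs_bound)
  also have "\<dots> \<le> (\<integral>w. S \<partial>\<psi>)"
    using z Q Q' le by (intro integral_mono) (auto intro!: integrable_next_value simp: space_\<psi>)
  finally have "\<bar>(\<integral>w. ?V Q w \<partial>\<psi>) - (\<integral>w. ?V Q' w \<partial>\<psi>)\<bar> \<le> S"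
    by (simp add: prob_space)
  then have "\<gamma> * \<bar>(\<integral>w. ?V Q w \<partial>\<psi>) - (\<integral>w. ?V Q' w \<partial>\<psi>)\<bar> \<le> \<gamma> * S"
    using \<gamma> by (intro mult_left_mono) auto
  then show ?thesis
    using \<gamma> by (simp add: bellman_def abs_mult flip: right_diff_distrib)
qed

end

section \<open>Kernel averages and the fixed-point error\<close>

text \<open>Collects what the Euclidean distance and \<open>dmix\<close> have in common. The
  constant \<open>C\<close> keeps the averaged powers of the distance bounded.\<close>

locale gaussian_smoothing = prob_space M for M :: "'z measure" +
  fixes d :: "'z \<Rightarrow> 'z \<Rightarrow> real" and C \<sigma> :: real
  assumes measurable_d: "\<And>z. z \<in> space M \<Longrightarrow> d z \<in> borel_measurable M"
    and d_nonneg: "\<And>z u. 0 \<le> d z u"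
    and d_le: "\<And>z u. z \<in> space M \<Longrightarrow> u \<in> space M \<Longrightarrow> d z u \<le> C"
begin

lemma measurable_kern: "z \<in> space M \<Longrightarrow> kern d \<sigma> z \<in> borel_measurable M"
  unfolding kern_def[abs_def] using measurable_d by measurable

lemma kern_pos: "0 < kern d \<sigma> z u"
  by (simp add: kern_def)

lemma kern_le_1: "kern d \<sigma> z u \<le> 1"
  by (simp add: kern_def)

lemma integrable_kern_mult:
  assumes "z \<in> space M" "g \<in> borel_measurable M" "\<And>u. u \<in> space M \<Longrightarrow> \<bar>g u\<bar> \<le> B"
  shows "integrable M (\<lambda>u. kern d \<sigma> z u * g u)"
proof (rule integrable_const_bound[where B = B])
  have "\<bar>kern d \<sigma> z u * g u\<bar> \<le> B" if "u \<in> space M" for u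
    using mult_mono[OF kern_le_1[of z u] assms(3)[OF that]] kern_pos[of z u] by (simp add: abs_mult)
  then show "AE u in M. norm (kern d \<sigma> z u * g u) \<le> B" by auto
  show "(\<lambda>u. kern d \<sigma> z u * g u) \<in> borel_measurable M"
    using measurable_kern[OF assms(1)] assms(2) by measurable
qed

lemma integrable_kern: "z \<in> space M \<Longrightarrow> integrable M (kern d \<sigma> z)"
  using integrable_kern_mult[of z "\<lambda>_. 1" 1] by simp

text \<open>With a vanishing denominator \<open>kavg\<close> would be 0 by convention; positivity
  makes it a genuine average, one that fixes constants.\<close>

lemma integral_kern_pos:
  assumes "z \<in> space M"
  shows "0 < (\<integral>u. kern d \<sigma> z u \<partial>M)"
proof -
  have "(\<integral>u. 0 \<partial>M) < (\<integral>u. kern d \<sigma> z u \<partial>M)"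
    by (rule integral_less_AE_space) (use assms in \<open>auto simp: integrable_kern kern_pos emeasure_space_1\<close>)
  then show ?thesis by simp
qed

text \<open>Kernel averaging is linear and positive. This form covers three later uses: bounding the
  average of a distance power, the Hoelder term, and the contraction term.\<close>

lemma kavg_diff_le:
  assumes z: "z \<in> space M"
    and g: "g \<in> borel_measurable M" "\<And>u. u \<in> space M \<Longrightarrow> \<bar>g u\<bar> \<le> B"
    and h: "h \<in> borel_measurable M" "\<And>u. u \<in> space M \<Longrightarrow> \<bar>h u\<bar> \<le> B'"
    and b: "b \<in> borel_measurable M" "\<And>u. u \<in> space M \<Longrightarrow> \<bar>b u\<bar> \<le> B''"
    and le: "\<And>u. u \<in> space M \<Longrightarrow> \<bar>g u - h u\<bar> \<le> b u"
  shows "\<bar>kavg (kern d \<sigma>) M g z - kavg (kern d \<sigma>) M h z\<bar> \<le> kavg (kern d \<sigma>) M b z"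
proof -
  note int = integrable_kern_mult[OF z g] integrable_kern_mult[OF z h] integrable_kern_mult[OF z b]
  have "\<bar>(\<integral>u. kern d \<sigma> z u * g u \<partial>M) - (\<integral>u. kern d \<sigma> z u * h u \<partial>M)\<bar>
      = \<bar>\<integral>u. kern d \<sigma> z u * g u - kern d \<sigma> z u * h u \<partial>M\<bar>"
    using int by simp
  also have "\<dots> \<le> (\<integral>u. \<bar>kern d \<sigma> z u * g u - kern d \<sigma> z u * h u\<bar> \<partial>M)"
    by (rule integral_abs_bound)
  also have "\<dots> \<le> (\<integral>u. kern d \<sigma> z u * b u \<partial>M)"
  proof (intro integral_mono)
    fix u assume "u \<in> space M"
    then show "\<bar>kern d \<sigma> z u * g u - kern d \<sigma> z u * h u\<bar> \<le> kern d \<sigma> z u * b u"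
      using le kern_pos[of z u] by (simp add: abs_mult mult_left_mono flip: right_diff_distrib)
  qed (use int in auto)
  finally show ?thesis
    using integral_kern_pos[OF z] by (simp add: kavg_def divide_right_mono flip: diff_divide_distrib)
qed

lemma kavg_const: "z \<in> space M \<Longrightarrow> kavg (kern d \<sigma>) M (\<lambda>_. c) z = c"
  using integral_kern_pos[of z] by (simp add: kavg_def integrable_kern)

lemma powr_d_bounded:
  "0 \<le> \<alpha> \<Longrightarrow> z \<in> space M \<Longrightarrow> u \<in> space M \<Longrightarrow> \<bar>d z u powr \<alpha>\<bar> \<le> C powr \<alpha>"
  by (auto intro!: powr_mono2 d_nonneg d_le)

lemma xi_eq_kavg:
  "xi d \<alpha> \<sigma> M Z = (SUP z\<in>Z. kavg (kern d \<sigma>) M (\<lambda>u. d z u powr \<alpha>) z)"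
  by (simp add: xi_def kavg_def mult.commute)

text \<open>A real supremum is known to dominate its members only for families bounded above; this
  uniform bound provides that for \<open>xi\<close>.\<close>

lemma kavg_powr_d_le:
  assumes "0 \<le> \<alpha>" "z \<in> space M"
  shows "kavg (kern d \<sigma>) M (\<lambda>u. d z u powr \<alpha>) z \<le> C powr \<alpha>"
proof -
  have m: "(\<lambda>u. d z u powr \<alpha>) \<in> borel_measurable M"
    using measurable_d[OF assms(2)] by measurable
  show ?thesis
    using kavg_diff_le[OF assms(2) m powr_d_bounded[OF assms] _ _ _ _, of "\<lambda>_. 0" 0 "\<lambda>_. C powr \<alpha>" "C powr \<alpha>"]
      powr_d_bounded[OF assms] assms(2) by (simp add: kavg_const)
qed

lemma kavg_powr_d_le_xi:
  assumes "0 \<le> \<alpha>" "z \<in> space M"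
  shows "kavg (kern d \<sigma>) M (\<lambda>u. d z u powr \<alpha>) z \<le> xi d \<alpha> \<sigma> M (space M)"
  unfolding xi_eq_kavg
  using assms kavg_powr_d_le by (intro cSUP_upper bdd_aboveI2[of _ _ "C powr \<alpha>"]) auto

text \<open>A negative \<open>L\<close> is allowed; it forces all distances to vanish.\<close>
lemma fixed_point_error:
  assumes \<alpha>: "0 < \<alpha>" and \<gamma>: "0 < \<gamma>" "\<gamma> < 1"
    and holder: "\<And>z u. z \<in> space M \<Longrightarrow> u \<in> space M \<Longrightarrow> \<bar>Q z - Q u\<bar> \<le> L * d z u powr \<alpha>"
    and Q: "Q \<in> borel_measurable M" "\<And>u. u \<in> space M \<Longrightarrow> \<bar>Q u\<bar> \<le> B"
    and Tq: "Tq \<in> borel_measurable M" "\<And>u. u \<in> space M \<Longrightarrow> \<bar>Tq u\<bar> \<le> B'"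
    and fixpoint: "\<And>z. z \<in> space M \<Longrightarrow> q z = kavg (kern d \<sigma>) M Tq z"
    and bdd: "bdd_above ((\<lambda>z. \<bar>Q z - q z\<bar>) ` space M)"
    and contr: "\<And>z. z \<in> space M \<Longrightarrow> \<bar>Q z - Tq z\<bar> \<le> \<gamma> * (SUP z\<in>space M. \<bar>Q z - q z\<bar>)"
  shows "(SUP z\<in>space M. \<bar>Q z - q z\<bar>) \<le> L / (1 - \<gamma>) * xi d \<alpha> \<sigma> M (space M)"
proof -
  let ?S = "SUP z\<in>space M. \<bar>Q z - q z\<bar>" and ?K = "kavg (kern d \<sigma>) M"
  have le_xi: "L * ?K (\<lambda>u. d z u powr \<alpha>) z \<le> L * xi d \<alpha> \<sigma> M (space M)" if z: "z \<in> space M" for z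
  proof (cases "0 \<le> L")
    case True
    then show ?thesis using kavg_powr_d_le_xi[of \<alpha> z] \<alpha> z by (intro mult_left_mono) auto
  next
    case False
    have "d z u powr \<alpha> = 0" if "z \<in> space M" "u \<in> space M" for z u
    proof -
      have "0 \<le> L * d z u powr \<alpha>" using holder[OF that] by linarith
      then show ?thesis using False by (simp add: zero_le_mult_iff)
    qed
    then have "?K (\<lambda>u. d z u powr \<alpha>) z = 0" if "z \<in> space M" for z
      using that by (simp add: kavg_def Bochner_Integration.integral_cong[where g = "\<lambda>_. 0"])
    then have "xi d \<alpha> \<sigma> M (space M) = 0" "?K (\<lambda>u. d z u powr \<alpha>) z = 0"
      using z not_empty by (simp_all add: xi_eq_kavg)
    then show ?thesis by simp
  qed
  have "?S \<le> L * xi d \<alpha> \<sigma> M (space M) + \<gamma> * ?S"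
  proof (rule cSUP_least[OF not_empty])
    fix z assume z: "z \<in> space M"
    have m: "(\<lambda>u. L * d z u powr \<alpha>) \<in> borel_measurable M"
      using measurable_d[OF z] by measurable
    \<comment> \<open>Averaging fixes constants, so \<open>Q z\<close> counts as the average of the
      constant function \<open>Q z\<close>, and the Hoelder condition compares it with
      \<open>Q u\<close> under the integral.\<close>
    have "\<bar>?K (\<lambda>_. Q z) z - ?K Q z\<bar> \<le> ?K (\<lambda>u. L * d z u powr \<alpha>) z"
      using z \<alpha> holder powr_d_bounded[of \<alpha> z]
      by (intro kavg_diff_le[OF z _ _ Q m, where B = "\<bar>Q z\<bar>" and B'' = "\<bar>L\<bar> * C powr \<alpha>"])
         (auto simp: abs_mult mult_left_mono)
    also have "\<dots> = L * ?K (\<lambda>u. d z u powr \<alpha>) z"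
      by (simp add: kavg_def mult.left_commute)
    also have "\<dots> \<le> L * xi d \<alpha> \<sigma> M (space M)"
      using le_xi[OF z] .
    finally have 1: "\<bar>Q z - ?K Q z\<bar> \<le> L * xi d \<alpha> \<sigma> M (space M)"
      using z by (simp add: kavg_const)
    \<comment> \<open>The fixed point \<open>q z\<close> is the average of \<open>Tq\<close>, and
      the contraction bound does not depend on the point, so it survives averaging
      unchanged.\<close>
    have "\<bar>?K Q z - ?K Tq z\<bar> \<le> ?K (\<lambda>_. \<gamma> * ?S) z"
      by (rule kavg_diff_le[OF z Q Tq _ _ contr]) auto
    then have 2: "\<bar>?K Q z - q z\<bar> \<le> \<gamma> * ?S"
      using z by (simp add: kavg_const fixpoint)
    show "\<bar>Q z - q z\<bar> \<le> L * xi d \<alpha> \<sigma> M (space M) + \<gamma> * ?S"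
      using 1 2 by linarith
  qed
  then have "(1 - \<gamma>) * ?S \<le> L * xi d \<alpha> \<sigma> M (space M)"
    by (simp add: algebra_simps)
  then show ?thesis
    using \<gamma> by (simp add: field_simps)
qed

end

lemma continuous_on_compact_real_bounded:
  fixes g :: "'a::topological_space \<Rightarrow> real"
  assumes "compact Z" "continuous_on Z g"
  obtains B where "\<And>u. u \<in> Z \<Longrightarrow> \<bar>g u\<bar> \<le> B"
  using compact_imp_bounded[OF compact_continuous_image[OF assms(2,1)]]
  by (auto simp: bounded_iff)

text \<open>Compactness of \<open>X \<times> A\<close> supplies what
  \<open>fixed_point_error\<close> asks for: \<open>Q\<close> and the Bellman image of
  \<open>q\<close> are continuous, hence bounded and measurable, and the sup distance is a true
  upper bound that can be fed into \<open>bellman_contraction\<close>.\<close>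

lemma (in bellman_model) smoothed_fixed_point_error:
  assumes "prob_space M" and sets_M: "sets M = sets (restrict_space borel (X \<times> A))"
    and d: "\<And>z. z \<in> X \<times> A \<Longrightarrow> d z \<in> borel_measurable M" "\<And>z u. 0 \<le> d z u"
      "\<And>z u. z \<in> X \<times> A \<Longrightarrow> u \<in> X \<times> A \<Longrightarrow> d z u \<le> C"
    and Q: "continuous_on (X \<times> A) Q" "\<And>z. z \<in> X \<times> A \<Longrightarrow> Q z = bellman \<gamma> r f \<psi> A Q z"
    and \<alpha>: "0 < \<alpha>"
    and holder: "\<And>z u. z \<in> X \<times> A \<Longrightarrow> u \<in> X \<times> A \<Longrightarrow> \<bar>Q z - Q u\<bar> \<le> L * d z u powr \<alpha>"
    and q: "continuous_on (X \<times> A) q"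
      "\<And>z. z \<in> X \<times> A \<Longrightarrow> q z = kavg (kern d \<sigma>) M (bellman \<gamma> r f \<psi> A q) z"
  shows "(SUP z\<in>X \<times> A. \<bar>Q z - q z\<bar>) \<le> L / (1 - \<gamma>) * xi d \<alpha> \<sigma> M (X \<times> A)"
proof -
  have sp: "space M = X \<times> A"
    using sets_eq_imp_space_eq[OF sets_M] by (simp add: space_restrict_space)
  interpret prob_space M by fact
  interpret gaussian_smoothing M d C \<sigma>
    by unfold_locales (use d sp in auto)
  have meas: "g \<in> borel_measurable M" if "continuous_on (X \<times> A) g" for g :: "'x \<times> 'b \<Rightarrow> real"
    unfolding measurable_cong_sets[OF sets_M refl] using that by (rule borel_measurable_continuous_on_restrict)
  have Z: "compact (X \<times> A)" using X A by (intro compact_Times)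
  note Tq = continuous_on_bellman[OF q(1)]
  obtain B where B: "\<And>u. u \<in> X \<times> A \<Longrightarrow> \<bar>Q u\<bar> \<le> B"
    using continuous_on_compact_real_bounded[OF Z Q(1)] by blast
  obtain B' where B': "\<And>u. u \<in> X \<times> A \<Longrightarrow> \<bar>bellman \<gamma> r f \<psi> A q u\<bar> \<le> B'"
    using continuous_on_compact_real_bounded[OF Z Tq] by blast
  have bdd: "bdd_above ((\<lambda>z. \<bar>Q z - q z\<bar>) ` (X \<times> A))"
    using Z Q(1) q(1) by (intro bounded_imp_bdd_above compact_imp_bounded compact_continuous_image continuous_intros)
  have le: "\<bar>Q z - q z\<bar> \<le> (SUP z\<in>X \<times> A. \<bar>Q z - q z\<bar>)" if "z \<in> X \<times> A" for z
    using that bdd by (intro cSUP_upper)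
  show ?thesis
    unfolding sp[symmetric]
  proof (rule fixed_point_error[OF \<alpha> \<gamma>, where B = B and B' = B' and Tq = "bellman \<gamma> r f \<psi> A q"])
    show "\<bar>Q z - bellman \<gamma> r f \<psi> A q z\<bar> \<le> \<gamma> * (SUP z\<in>space M. \<bar>Q z - q z\<bar>)" if "z \<in> space M" for z
      using bellman_contraction[OF Q(1) q(1) le, of z] Q(2)[of z] that unfolding sp by simp
  qed (use holder Q q B B' bdd meas Tq in \<open>auto simp: sp\<close>)
qed

section \<open>Densities bounded above and below\<close>

text \<open>The density is replaced by its essential supremum in the numerator and by its essential
  infimum in the denominator, leaving integrals over \<open>N\<close>. The common scale
  \<open>T\<close> cancels, and the 2 comes from the half mass in \<open>lower\<close>.\<close>

lemma density_ratio_bound: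
  assumes p[measurable]: "p \<in> borel_measurable N"
    and M: "M = density N (\<lambda>u. ennreal (p u))" "prob_space M"
    and inf: "0 < essinf N (\<lambda>u. ereal (p u))" and sup: "esssup N (\<lambda>u. ereal (p u)) < \<infinity>"
    and g[measurable]: "g \<in> borel_measurable N" and g_nonneg: "\<And>u. 0 \<le> g u"
    and k[measurable]: "k \<in> borel_measurable N" and k_nonneg: "\<And>u. 0 \<le> k u" and k_int: "integrable M k"
    and T: "0 < T" and v: "0 < v" and B: "0 \<le> B"
    and upper: "(\<integral>\<^sup>+u. ennreal (g u) \<partial>N) \<le> ennreal (B * T)"
    and lower: "ennreal (v * (T / 2)) \<le> (\<integral>\<^sup>+u. ennreal (k u) \<partial>N)"
  shows "(\<integral>u. g u \<partial>M) / (\<integral>u. k u \<partial>M)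
    \<le> 2 / v * (real_of_ereal (esssup N (\<lambda>u. ereal (p u))) / real_of_ereal (essinf N (\<lambda>u. ereal (p u)))) * B"
proof -
  interpret M: prob_space M by fact
  define P where "P = real_of_ereal (esssup N (\<lambda>u. ereal (p u)))"
  define Q where "Q = real_of_ereal (essinf N (\<lambda>u. ereal (p u)))"
  have ae: "AE u in N. ereal (p u) \<le> esssup N (\<lambda>u. ereal (p u)) \<and> essinf N (\<lambda>u. ereal (p u)) \<le> ereal (p u)"
    using esssup_AE[of "\<lambda>u. ereal (p u)" N] esssup_AE[of "\<lambda>u. - ereal (p u)" N]
    unfolding essinf_def by eventually_elim (auto simp: ereal_uminus_le_reorder)
  \<comment> \<open>Since \<open>M\<close> has mass 1, a null set of \<open>N\<close> cannot be the
    whole space, so some \<open>u0\<close> satisfies \<open>ae\<close>. Its real value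
    \<open>p u0\<close> lies between the two essential bounds and, with \<open>inf\<close> and
    \<open>sup\<close>, makes both of them finite.\<close>
  have "ae_filter N \<noteq> bot"
  proof
    assume "ae_filter N = bot"
    then have "AE u in N. False" by (simp add: trivial_limit_def)
    then have "AE u in M. False" unfolding M(1) by (subst AE_density) auto
    then show False using M.AE_False by simp
  qed
  then obtain u0 where "ereal (p u0) \<le> esssup N (\<lambda>u. ereal (p u))" "essinf N (\<lambda>u. ereal (p u)) \<le> ereal (p u0)"
    using eventually_happens'[OF _ ae] by blast
  then have P: "esssup N (\<lambda>u. ereal (p u)) = ereal P" and Q: "essinf N (\<lambda>u. ereal (p u)) = ereal Q"
    using inf sup unfolding P_def Q_def by (auto simp: ereal_real)
  have Q0: "0 < Q" using inf by (simp add: Q)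
  have ae': "AE u in N. p u \<le> P \<and> Q \<le> p u" using ae by (simp add: P Q)
  have P0: "0 \<le> P"
    using \<open>ereal (p u0) \<le> _\<close> \<open>_ \<le> ereal (p u0)\<close> Q0 unfolding P Q by simp
  have "(\<integral>\<^sup>+u. ennreal (g u) \<partial>M) = (\<integral>\<^sup>+u. ennreal (p u) * ennreal (g u) \<partial>N)"
    unfolding M(1) by (simp add: nn_integral_density)
  also have "\<dots> \<le> (\<integral>\<^sup>+u. ennreal P * ennreal (g u) \<partial>N)"
    using ae' by (intro nn_integral_mono_AE) (auto intro!: mult_right_mono ennreal_leI)
  also have "\<dots> \<le> ennreal (P * (B * T))"
    using P0 by (simp add: nn_integral_cmult ennreal_mult' mult_left_mono upper)
  finally have "(\<integral>u. g u \<partial>M) \<le> P * (B * T)"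
    using P0 B T g_nonneg by (subst integral_eq_nn_integral) (auto simp: M(1) intro!: enn2real_leI)
  have "ennreal (Q * (v * (T / 2))) \<le> ennreal Q * (\<integral>\<^sup>+u. ennreal (k u) \<partial>N)"
    using Q0 by (simp only: ennreal_mult' less_imp_le) (intro mult_left_mono lower, simp)
  also have "\<dots> = (\<integral>\<^sup>+u. ennreal Q * ennreal (k u) \<partial>N)"
    by (simp add: nn_integral_cmult)
  also have "\<dots> \<le> (\<integral>\<^sup>+u. ennreal (p u) * ennreal (k u) \<partial>N)"
    using ae' by (intro nn_integral_mono_AE) (auto intro!: mult_right_mono ennreal_leI)
  also have "\<dots> = (\<integral>\<^sup>+u. ennreal (k u) \<partial>M)"
    unfolding M(1) by (simp add: nn_integral_density)
  \<comment> \<open>Integrability matters on this side: the Bochner integral of a nonintegrable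
    \<open>k\<close> is 0, which would destroy a lower bound.\<close>
  also have "\<dots> = ennreal (\<integral>u. k u \<partial>M)"
    using k_int k_nonneg by (intro nn_integral_eq_integral) auto
  finally have den: "Q * (v * (T / 2)) \<le> (\<integral>u. k u \<partial>M)"
    using k_nonneg by (simp add: Bochner_Integration.integral_nonneg)
  have "(\<integral>u. g u \<partial>M) / (\<integral>u. k u \<partial>M) \<le> P * (B * T) / (Q * (v * (T / 2)))"
    using \<open>(\<integral>u. g u \<partial>M) \<le> P * (B * T)\<close> den Q0 v T g_nonneg P0 B by (intro frac_le) auto
  also have "\<dots> = 2 / v * (P / Q) * B"
    using T v Q0 by (simp add: field_simps)
  finally show ?thesis by (simp add: P_def Q_def)
qed

section \<open>Rates for the smoothing error\<close>

lemma powr_mult_sqrt: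
  fixes \<sigma> \<alpha> :: real
  assumes "0 < \<sigma>"
  shows "(\<sigma> * sqrt (real n)) powr \<alpha> = real n powr (\<alpha> / 2) * \<sigma> powr \<alpha>"
  using assms by (simp add: powr_mult powr_half_sqrt[symmetric] powr_powr)

text \<open>For each \<open>z\<close>, \<open>density_ratio_bound\<close> applies with
  \<open>B = R powr \<alpha>\<close>: the numerator is enlarged from \<open>Z\<close> to the whole
  space, and the denominator is bounded below by the thick set estimate at radius
  \<open>R\<close>.\<close>

lemma xi_dist_le:
  fixes Z :: "'z::euclidean_space set" and p :: "'z \<Rightarrow> real"
  defines "N \<equiv> restrict_space lborel Z"
  assumes Z: "compact Z" and p: "p \<in> borel_measurable N"
    and M: "M = density N (\<lambda>u. ennreal (p u))" "prob_space M"
    and inf: "0 < essinf N (\<lambda>u. ereal (p u))" and sup: "esssup N (\<lambda>u. ereal (p u)) < \<infinity>"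
    and v: "0 < v" and \<sigma>: "0 < \<sigma>" and \<alpha>: "0 < \<alpha>" "\<alpha> \<le> 1"
    and thick: "\<And>z \<rho>. z \<in> Z \<Longrightarrow> 0 < \<rho> \<Longrightarrow> \<rho> \<le> \<sigma> * sqrt (real DIM('z)) \<Longrightarrow>
      ennreal (v * ball_vol DIM('z) \<rho>) \<le> emeasure lborel {u \<in> Z. dist z u \<le> \<rho>}"
  shows "xi dist \<alpha> \<sigma> M Z
    \<le> 2 / v * (real_of_ereal (esssup N (\<lambda>u. ereal (p u))) / real_of_ereal (essinf N (\<lambda>u. ereal (p u))))
      * (real DIM('z) powr (\<alpha> / 2) * \<sigma> powr \<alpha>)"
proof -
  interpret M: prob_space M by fact
  have Z_borel: "Z \<in> sets borel" using Z by (simp add: borel_compact)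
  have sp: "space M = Z" by (simp add: M(1) N_def space_restrict_space)
  have meas: "h \<in> borel_measurable M" if "h \<in> borel_measurable borel" for h :: "'z \<Rightarrow> real"
    using that unfolding M(1) N_def by (simp add: measurable_restrict_space1)
  interpret gaussian_smoothing M dist "diameter Z" \<sigma>
  proof unfold_locales
    show "dist z u \<le> diameter Z" if "z \<in> space M" "u \<in> space M" for z u
      using that Z unfolding sp by (intro diameter_bounded_bound compact_imp_bounded)
  qed (auto intro: meas)
  have [measurable]: "kern dist \<sigma> z \<in> borel_measurable borel" for z :: 'z
    unfolding kern_def[abs_def] by measurable
  show ?thesis
    unfolding xi_def
  proof (rule cSUP_least)
    show "Z \<noteq> {}" using M.not_empty by (simp add: sp)
    fix z assume z: "z \<in> Z"
    let ?R = "\<sigma> * sqrt (real DIM('z))"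
    let ?e = "\<lambda>u. exp (- (dist z u)\<^sup>2 / (2 * \<sigma>\<^sup>2))"
    obtain T where T: "0 < T"
      "(\<integral>\<^sup>+u. ennreal (?e u) \<partial>lborel) = ennreal T"
      "(\<integral>\<^sup>+u. ennreal (dist z u powr \<alpha> * ?e u) \<partial>lborel) \<le> ennreal (?R powr \<alpha> * T)"
      "ennreal (T / 2) \<le> (\<integral>\<^sup>+u. ennreal (?e u) * indicator (cball z ?R) u \<partial>lborel)"
      using gaussian_integral_bounds[OF \<sigma> \<alpha>, of z] .
    have "(\<integral>\<^sup>+u. ennreal (dist z u powr \<alpha> * kern dist \<sigma> z u) \<partial>N)
        = (\<integral>\<^sup>+u. ennreal (dist z u powr \<alpha> * ?e u) * indicator Z u \<partial>lborel)"
      using Z_borel by (simp add: N_def nn_integral_restrict_space kern_def)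
    also have "\<dots> \<le> (\<integral>\<^sup>+u. ennreal (dist z u powr \<alpha> * ?e u) \<partial>lborel)"
      by (intro nn_integral_mono) (auto split: split_indicator)
    also note T(3)
    finally have upper: "(\<integral>\<^sup>+u. ennreal (dist z u powr \<alpha> * kern dist \<sigma> z u) \<partial>N) \<le> ennreal (?R powr \<alpha> * T)" .
    have "ennreal (v * (T / 2)) = ennreal v * ennreal (T / 2)"
      using v by (simp add: ennreal_mult' flip: times_divide_eq_right)
    also have "\<dots> \<le> ennreal v * (\<integral>\<^sup>+u. ennreal (?e u) * indicator (cball z ?R) u \<partial>lborel)"
      by (intro mult_left_mono T(4)) simp
    also have "\<dots> \<le> (\<integral>\<^sup>+u. ennreal (?e u) * indicator Z u \<partial>lborel)"
      using \<sigma> v Z_borel z by (intro gaussian_integral_thick_ge thick) auto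
    also have "\<dots> = (\<integral>\<^sup>+u. ennreal (kern dist \<sigma> z u) \<partial>N)"
      using Z_borel by (simp add: N_def nn_integral_restrict_space kern_def)
    finally have lower: "ennreal (v * (T / 2)) \<le> (\<integral>\<^sup>+u. ennreal (kern dist \<sigma> z u) \<partial>N)" .
    show "(\<integral>u. dist z u powr \<alpha> * kern dist \<sigma> z u \<partial>M) / (\<integral>u. kern dist \<sigma> z u \<partial>M)
      \<le> 2 / v * (real_of_ereal (esssup N (\<lambda>u. ereal (p u))) / real_of_ereal (essinf N (\<lambda>u. ereal (p u))))
        * (real DIM('z) powr (\<alpha> / 2) * \<sigma> powr \<alpha>)"
      unfolding powr_mult_sqrt[OF \<sigma>, symmetric]
    proof (rule density_ratio_bound[OF p M inf sup _ _ _ _ _ T(1) v _ upper lower])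
      show "(\<lambda>u. dist z u powr \<alpha> * kern dist \<sigma> z u) \<in> borel_measurable N"
           "kern dist \<sigma> z \<in> borel_measurable N"
        unfolding N_def by (auto intro!: measurable_restrict_space1)
      show "integrable M (kern dist \<sigma> z)" using z by (intro integrable_kern) (simp add: sp)
    qed (auto simp: kern_def)
  qed
qed

section \<open>The mixed metric with finitely many actions\<close>

lemma dmix_same_action: "dmix (x, i) (y, i) = dist x y"
  by (simp add: dmix_def dist_norm)

lemma dmix_sq: "(dmix (x, i) (y, j))\<^sup>2 = (dist x y)\<^sup>2 + (if i = j then 0 else 1)"
  by (simp add: dmix_def dist_norm)

text \<open>Rests on \<open>a\<^sup>2 + 1 \<le> (a + 1)\<^sup>2\<close> for nonnegative
  \<open>a\<close>; this is the origin of \<open>diameter X + 1\<close> in the rate.\<close>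

lemma dmix_le: "dmix z u \<le> dist (fst z) (fst u) + 1"
  by (rule power2_le_imp_le) (auto simp: dmix_def dist_norm power2_sum)

lemma measurable_dmix:
  fixes z :: "'y::euclidean_space \<times> 'b::countable"
  shows "dmix z \<in> borel_measurable (lborel \<Otimes>\<^sub>M count_space UNIV)"
  unfolding dmix_def[abs_def] by measurable

text \<open>Tonelli's theorem against counting measure. It reduces the mixed reference measure to
  one Lebesgue integral per action, where the Euclidean estimates apply.\<close>

lemma nn_integral_lborel_times_finite:
  fixes X :: "'y::euclidean_space set" and A :: "nat set"
  assumes X: "X \<in> sets borel" and A: "finite A"
    and h[measurable]: "h \<in> borel_measurable (lborel \<Otimes>\<^sub>M count_space UNIV)"
  shows "(\<integral>\<^sup>+u. h u \<partial>restrict_space (lborel \<Otimes>\<^sub>M count_space UNIV) (X \<times> A))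
    = (\<Sum>j\<in>A. \<integral>\<^sup>+y. h (y, j) * indicator X y \<partial>lborel)"
proof -
  interpret C: sigma_finite_measure "count_space (UNIV :: nat set)"
    by (rule sigma_finite_measure_count_space)
  interpret pair_sigma_finite "lborel :: 'y measure" "count_space (UNIV :: nat set)" ..
  have XA[measurable]: "X \<times> A \<in> sets (lborel \<Otimes>\<^sub>M count_space UNIV)"
    using X by (intro pair_measureI) auto
  have "(\<integral>\<^sup>+u. h u \<partial>restrict_space (lborel \<Otimes>\<^sub>M count_space UNIV) (X \<times> A))
      = (\<integral>\<^sup>+u. h u * indicator (X \<times> A) u \<partial>(lborel \<Otimes>\<^sub>M count_space UNIV))"
    using XA by (intro nn_integral_restrict_space) simp
  also have "\<dots> = (\<integral>\<^sup>+j. \<integral>\<^sup>+y. h (y, j) * indicator (X \<times> A) (y, j) \<partial>lborel \<partial>count_space UNIV)"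
    by (rule nn_integral_snd[symmetric]) measurable
  also have "\<dots> = (\<Sum>j\<in>A. \<integral>\<^sup>+y. h (y, j) * indicator (X \<times> A) (y, j) \<partial>lborel)"
    using A by (intro nn_integral_count_space') auto
  also have "\<dots> = (\<Sum>j\<in>A. \<integral>\<^sup>+y. h (y, j) * indicator X y \<partial>lborel)"
    by (intro sum.cong nn_integral_cong refl) (auto split: split_indicator)
  finally show ?thesis .
qed

text \<open>The numerator splits by action: the action of \<open>z\<close> itself gives the
  Euclidean moment, and every other one contributes at most \<open>?K * T\<close>. The denominator
  keeps only the action of \<open>z\<close>, on which \<open>dmix\<close> is the Euclidean
  distance.\<close>

lemma xi_dmix_le:
  fixes X :: "'y::euclidean_space set" and A :: "nat set" and p :: "'y \<times> nat \<Rightarrow> real"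
  defines "N \<equiv> restrict_space (lborel \<Otimes>\<^sub>M count_space UNIV) (X \<times> A)"
  assumes X: "compact X" and A: "finite A" and p: "p \<in> borel_measurable N"
    and M: "M = density N (\<lambda>u. ennreal (p u))" "prob_space M"
    and inf: "0 < essinf N (\<lambda>u. ereal (p u))" and sup: "esssup N (\<lambda>u. ereal (p u)) < \<infinity>"
    and v: "0 < v" and \<sigma>: "0 < \<sigma>" and \<alpha>: "0 < \<alpha>" "\<alpha> \<le> 1"
    and thick: "\<And>x \<rho>. x \<in> X \<Longrightarrow> 0 < \<rho> \<Longrightarrow> \<rho> \<le> \<sigma> * sqrt (real DIM('y)) \<Longrightarrow>
      ennreal (v * ball_vol DIM('y) \<rho>) \<le> emeasure lborel {y \<in> X. dist x y \<le> \<rho>}"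
  shows "xi dmix \<alpha> \<sigma> M (X \<times> A)
    \<le> 2 / v * (real_of_ereal (esssup N (\<lambda>u. ereal (p u))) / real_of_ereal (essinf N (\<lambda>u. ereal (p u))))
      * (real DIM('y) powr (\<alpha> / 2) * \<sigma> powr \<alpha>
         + (real (card A) - 1) * (diameter X + 1) powr \<alpha> * exp (- 1 / (2 * \<sigma>\<^sup>2)))"
proof -
  interpret M: prob_space M by fact
  have X_borel: "X \<in> sets borel" using X by (simp add: borel_compact)
  have sp: "space M = X \<times> A" by (simp add: M(1) N_def space_restrict_space space_pair_measure)
  have diam: "dist x y \<le> diameter X" if "x \<in> X" "y \<in> X" for x y
    using that X by (intro diameter_bounded_bound compact_imp_bounded)
  have dmix_diam: "dmix z u \<le> diameter X + 1" if "z \<in> X \<times> A" "u \<in> X \<times> A" for z u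
    using dmix_le[of z u] diam[of "fst z" "fst u"] that by auto
  have meas: "h \<in> borel_measurable M" if "h \<in> borel_measurable (lborel \<Otimes>\<^sub>M count_space UNIV)" for h :: "'y \<times> nat \<Rightarrow> real"
    using that unfolding M(1) N_def by (simp add: measurable_restrict_space1)
  interpret gaussian_smoothing M dmix "diameter X + 1" \<sigma>
  proof unfold_locales
    show "dmix z u \<le> diameter X + 1" if "z \<in> space M" "u \<in> space M" for z u
      using that unfolding sp by (rule dmix_diam)
  qed (auto intro: meas measurable_dmix simp: dmix_def)
  note [measurable] = measurable_dmix
  have [measurable]: "kern dmix \<sigma> z \<in> borel_measurable (lborel \<Otimes>\<^sub>M count_space UNIV)" for z :: "'y \<times> nat"
    unfolding kern_def[abs_def] by measurable
  let ?K = "(diameter X + 1) powr \<alpha> * exp (- 1 / (2 * \<sigma>\<^sup>2))"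
  show ?thesis
    unfolding xi_def
  proof (rule cSUP_least)
    show "X \<times> A \<noteq> {}" using M.not_empty by (simp add: sp)
    fix z assume z: "z \<in> X \<times> A"
    obtain x i where zi: "z = (x, i)" and x: "x \<in> X" and i: "i \<in> A" using z by auto
    let ?R = "\<sigma> * sqrt (real DIM('y))"
    let ?e = "\<lambda>y. exp (- (dist x y)\<^sup>2 / (2 * \<sigma>\<^sup>2))"
    let ?g = "\<lambda>u. dmix z u powr \<alpha> * kern dmix \<sigma> z u"
    obtain T where T: "0 < T"
      "(\<integral>\<^sup>+y. ennreal (?e y) \<partial>lborel) = ennreal T"
      "(\<integral>\<^sup>+y. ennreal (dist x y powr \<alpha> * ?e y) \<partial>lborel) \<le> ennreal (?R powr \<alpha> * T)"
      "ennreal (T / 2) \<le> (\<integral>\<^sup>+y. ennreal (?e y) * indicator (cball x ?R) y \<partial>lborel)"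
      using gaussian_integral_bounds[OF \<sigma> \<alpha>, of x] .
    \<comment> \<open>Membership of \<open>i\<close> makes the real subtraction agree with the count
      of the other actions, and so the coefficient is nonnegative.\<close>
    have card: "real (card (A - {i})) = real (card A) - 1"
      using i A card_gt_0_iff[of A] by (auto simp: card_Diff_singleton of_nat_diff)
    have same: "(\<integral>\<^sup>+y. ennreal (?g (y, i)) * indicator X y \<partial>lborel) \<le> ennreal (?R powr \<alpha> * T)"
    proof -
      have "(\<integral>\<^sup>+y. ennreal (?g (y, i)) * indicator X y \<partial>lborel) \<le> (\<integral>\<^sup>+y. ennreal (dist x y powr \<alpha> * ?e y) \<partial>lborel)"
        by (intro nn_integral_mono) (auto simp: zi kern_def dmix_same_action split: split_indicator)
      then show ?thesis using T(3) by (rule order_trans)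
    qed
    have other: "(\<integral>\<^sup>+y. ennreal (?g (y, j)) * indicator X y \<partial>lborel) \<le> ennreal (?K * T)" if j: "j \<in> A - {i}" for j
    proof -
      have "?g (y, j) \<le> ?K * ?e y" if "y \<in> X" for y
      proof -
        \<comment> \<open>The unit term of the squared mixed distance factors out of the
          exponential, separating the penalty for a different action from the Euclidean
          kernel.\<close>
        have "kern dmix \<sigma> z (y, j) = exp (- 1 / (2 * \<sigma>\<^sup>2)) * ?e y"
          using j by (auto simp: zi kern_def dmix_sq add_divide_distrib diff_divide_distrib mult_exp_exp)
        moreover have "dmix z (y, j) powr \<alpha> \<le> (diameter X + 1) powr \<alpha>"
          using \<alpha> dmix_diam[OF z, of "(y, j)"] that j by (intro powr_mono2) (auto simp: d_nonneg)
        ultimately show ?thesis by (simp add: mult.assoc mult_right_mono)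
      qed
      then have "(\<integral>\<^sup>+y. ennreal (?g (y, j)) * indicator X y \<partial>lborel) \<le> (\<integral>\<^sup>+y. ennreal ?K * ennreal (?e y) \<partial>lborel)"
        by (intro nn_integral_mono) (auto simp: ennreal_mult'[symmetric] intro!: ennreal_leI split: split_indicator)
      also have "\<dots> = ennreal (?K * T)"
        by (subst nn_integral_cmult) (auto simp: T(2)[simplified] ennreal_mult')
      finally show ?thesis .
    qed
    have "(\<integral>\<^sup>+u. ennreal (?g u) \<partial>N) = (\<Sum>j\<in>A. \<integral>\<^sup>+y. ennreal (?g (y, j)) * indicator X y \<partial>lborel)"
      unfolding N_def using X_borel A by (intro nn_integral_lborel_times_finite) auto
    also have "\<dots> = (\<integral>\<^sup>+y. ennreal (?g (y, i)) * indicator X y \<partial>lborel)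
        + (\<Sum>j\<in>A - {i}. \<integral>\<^sup>+y. ennreal (?g (y, j)) * indicator X y \<partial>lborel)"
      using A i by (rule sum.remove)
    also have "\<dots> \<le> ennreal (?R powr \<alpha> * T) + (\<Sum>j\<in>A - {i}. ennreal (?K * T))"
      by (intro add_mono same sum_mono other)
    also have "(\<Sum>j\<in>A - {i}. ennreal (?K * T)) = ennreal (real (card (A - {i})) * (?K * T))"
      using T(1) by (subst sum_ennreal) auto
    also have "ennreal (?R powr \<alpha> * T) + ennreal (real (card (A - {i})) * (?K * T))
        = ennreal (?R powr \<alpha> * T + real (card (A - {i})) * (?K * T))"
      using T(1) by (intro ennreal_plus[symmetric]) auto
    also have "?R powr \<alpha> * T + real (card (A - {i})) * (?K * T)
        = (?R powr \<alpha> + (real (card A) - 1) * (diameter X + 1) powr \<alpha> * exp (- 1 / (2 * \<sigma>\<^sup>2))) * T"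
      unfolding card by (simp add: algebra_simps)
    finally have upper: "(\<integral>\<^sup>+u. ennreal (?g u) \<partial>N)
        \<le> ennreal ((?R powr \<alpha> + (real (card A) - 1) * (diameter X + 1) powr \<alpha> * exp (- 1 / (2 * \<sigma>\<^sup>2))) * T)" .
    have "ennreal (v * (T / 2)) = ennreal v * ennreal (T / 2)"
      using v by (simp add: ennreal_mult' flip: times_divide_eq_right)
    also have "\<dots> \<le> ennreal v * (\<integral>\<^sup>+y. ennreal (?e y) * indicator (cball x ?R) y \<partial>lborel)"
      by (intro mult_left_mono T(4)) simp
    also have "\<dots> \<le> (\<integral>\<^sup>+y. ennreal (?e y) * indicator X y \<partial>lborel)"
      using \<sigma> v X_borel x by (intro gaussian_integral_thick_ge thick) auto
    also have "\<dots> = (\<integral>\<^sup>+y. ennreal (kern dmix \<sigma> z (y, i)) * indicator X y \<partial>lborel)"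
      by (simp add: zi kern_def dmix_same_action)
    also have "\<dots> \<le> (\<Sum>j\<in>A. \<integral>\<^sup>+y. ennreal (kern dmix \<sigma> z (y, j)) * indicator X y \<partial>lborel)"
      using A i by (intro member_le_sum) auto
    also have "\<dots> = (\<integral>\<^sup>+u. ennreal (kern dmix \<sigma> z u) \<partial>N)"
      unfolding N_def using X_borel A by (intro nn_integral_lborel_times_finite[symmetric]) auto
    finally have lower: "ennreal (v * (T / 2)) \<le> (\<integral>\<^sup>+u. ennreal (kern dmix \<sigma> z u) \<partial>N)" .
    show "(\<integral>u. ?g u \<partial>M) / (\<integral>u. kern dmix \<sigma> z u \<partial>M)
      \<le> 2 / v * (real_of_ereal (esssup N (\<lambda>u. ereal (p u))) / real_of_ereal (essinf N (\<lambda>u. ereal (p u))))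
        * (real DIM('y) powr (\<alpha> / 2) * \<sigma> powr \<alpha>
           + (real (card A) - 1) * (diameter X + 1) powr \<alpha> * exp (- 1 / (2 * \<sigma>\<^sup>2)))"
      unfolding powr_mult_sqrt[OF \<sigma>, symmetric]
    proof (rule density_ratio_bound[OF p M inf sup _ _ _ _ _ T(1) v _ upper lower])
      show "?g \<in> borel_measurable N" "kern dmix \<sigma> z \<in> borel_measurable N"
        unfolding N_def by (auto intro!: measurable_restrict_space1)
      show "integrable M (kern dmix \<sigma> z)" using z by (intro integrable_kern) (simp add: sp)
      show "0 \<le> ?R powr \<alpha> + (real (card A) - 1) * (diameter X + 1) powr \<alpha> * exp (- 1 / (2 * \<sigma>\<^sup>2))"
        unfolding card[symmetric] by simp
    qed (auto simp: kern_def)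
  qed
qed

text \<open>Every set of naturals is Borel, so the reference measure carries the Borel sets of the
  product. This makes continuous functions on \<open>X \<times> A\<close> measurable for
  \<open>M\<close> in the finite case.\<close>

lemma sets_lborel_times_nat:
  "sets ((lborel :: 'y::euclidean_space measure) \<Otimes>\<^sub>M count_space (UNIV :: nat set)) = sets borel"
proof -
  have "sets ((lborel :: 'y measure) \<Otimes>\<^sub>M count_space (UNIV :: nat set)) = sets (borel \<Otimes>\<^sub>M borel)"
    by (intro sets_pair_measure_cong) (simp_all add: sets_borel_eq_count_space)
  then show ?thesis by (simp only: borel_prod)
qed

text \<open>Action labels of the finite case are encoded as naturals. Both fixed points enter as
  arbitrary continuous solutions of their equations, so the estimates apply in particular to the
  unique ones.\<close>

theorem theorem2:
  shows
  "(\<forall>(\<gamma>::real) (X::'x::euclidean_space set) (A::'a::euclidean_space set) (W::'w::euclidean_space set)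
      (\<psi>::'w measure) (f::('x \<times> 'a) \<times> 'w \<Rightarrow> 'x) (r::'x \<times> 'a \<Rightarrow> real)
      (M::('x \<times> 'a) measure) (Qs::'x \<times> 'a \<Rightarrow> real) (\<alpha>::real) (LQ::real).
     0 < \<gamma> \<and> \<gamma> < 1 \<and> compact X \<and> X \<noteq> {} \<and> compact A \<and> A \<noteq> {} \<and>
     W \<in> sets borel \<and> prob_space \<psi> \<and> sets \<psi> = sets (restrict_space borel W) \<and>
     continuous_on ((X \<times> A) \<times> W) f \<and> (\<forall>z\<in>X \<times> A. \<forall>w\<in>W. f (z, w) \<in> X) \<and>
     continuous_on (X \<times> A) r \<and> (\<forall>z\<in>X \<times> A. \<bar>r z\<bar> \<le> 1) \<and>
     prob_space M \<and> sets M = sets (restrict_space lborel (X \<times> A)) \<and>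
     continuous_on (X \<times> A) Qs \<and> (\<forall>z\<in>X \<times> A. Qs z = bellman \<gamma> r f \<psi> A Qs z) \<and>
     0 < \<alpha> \<and> \<alpha> \<le> 1 \<and>
     (\<forall>z\<in>X \<times> A. \<forall>u\<in>X \<times> A. \<bar>Qs z - Qs u\<bar> \<le> LQ * dist z u powr \<alpha>)
     \<longrightarrow>
     (\<forall>\<sigma>>0. \<forall>qs::'x \<times> 'a \<Rightarrow> real.
        continuous_on (X \<times> A) qs \<and>
        (\<forall>z\<in>X \<times> A. qs z = kavg (kern dist \<sigma>) M (bellman \<gamma> r f \<psi> A qs) z)
        \<longrightarrow> (SUP z\<in>X \<times> A. \<bar>Qs z - qs z\<bar>) \<le> LQ / (1 - \<gamma>) * xi dist \<alpha> \<sigma> M (X \<times> A)) \<and>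
     (\<forall>(p::'x \<times> 'a \<Rightarrow> real) (v::real) (\<sigma>v::real).
        p \<in> borel_measurable (restrict_space lborel (X \<times> A)) \<and> (\<forall>u\<in>X \<times> A. 0 \<le> p u) \<and>
        M = density (restrict_space lborel (X \<times> A)) (\<lambda>u. ennreal (p u)) \<and>
        0 < essinf (restrict_space lborel (X \<times> A)) (\<lambda>u. ereal (p u)) \<and>
        esssup (restrict_space lborel (X \<times> A)) (\<lambda>u. ereal (p u)) < \<infinity> \<and>
        0 < v \<and> v \<le> 1 \<and> 0 < \<sigma>v \<and>
        (\<forall>z\<in>X \<times> A. \<forall>\<rho>. 0 < \<rho> \<and> \<rho> \<le> \<sigma>v * sqrt (real (DIM('x) + DIM('a))) \<longrightarrow>
           emeasure lborel {u\<in>X \<times> A. dist z u \<le> \<rho>}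
             \<ge> ennreal (v * ball_vol (DIM('x) + DIM('a)) \<rho>))
        \<longrightarrow>
        (\<forall>\<sigma>. 0 < \<sigma> \<and> \<sigma> \<le> \<sigma>v \<longrightarrow>
           xi dist \<alpha> \<sigma> M (X \<times> A)
             \<le> 2 / v * (real_of_ereal (esssup (restrict_space lborel (X \<times> A)) (\<lambda>u. ereal (p u)))
                        / real_of_ereal (essinf (restrict_space lborel (X \<times> A)) (\<lambda>u. ereal (p u))))
               * real (DIM('x) + DIM('a)) powr (\<alpha> / 2) * \<sigma> powr \<alpha>)))
   \<and>
   (\<forall>(\<gamma>::real) (X::'y::euclidean_space set) (A::nat set) (W::'v::euclidean_space set)
      (\<psi>::'v measure) (f::('y \<times> nat) \<times> 'v \<Rightarrow> 'y) (r::'y \<times> nat \<Rightarrow> real)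
      (M::('y \<times> nat) measure) (Qs::'y \<times> nat \<Rightarrow> real) (\<alpha>::real) (LQ::real).
     0 < \<gamma> \<and> \<gamma> < 1 \<and> compact X \<and> X \<noteq> {} \<and> finite A \<and> A \<noteq> {} \<and>
     W \<in> sets borel \<and> prob_space \<psi> \<and> sets \<psi> = sets (restrict_space borel W) \<and>
     continuous_on ((X \<times> A) \<times> W) f \<and> (\<forall>z\<in>X \<times> A. \<forall>w\<in>W. f (z, w) \<in> X) \<and>
     continuous_on (X \<times> A) r \<and> (\<forall>z\<in>X \<times> A. \<bar>r z\<bar> \<le> 1) \<and>
     prob_space M \<and>
     sets M = sets (restrict_space (lborel \<Otimes>\<^sub>M count_space UNIV) (X \<times> A)) \<and>
     continuous_on (X \<times> A) Qs \<and> (\<forall>z\<in>X \<times> A. Qs z = bellman \<gamma> r f \<psi> A Qs z) \<and>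
     0 < \<alpha> \<and> \<alpha> \<le> 1 \<and>
     (\<forall>z\<in>X \<times> A. \<forall>u\<in>X \<times> A. \<bar>Qs z - Qs u\<bar> \<le> LQ * dmix z u powr \<alpha>)
     \<longrightarrow>
     (\<forall>\<sigma>>0. \<forall>qs::'y \<times> nat \<Rightarrow> real.
        continuous_on (X \<times> A) qs \<and>
        (\<forall>z\<in>X \<times> A. qs z = kavg (kern dmix \<sigma>) M (bellman \<gamma> r f \<psi> A qs) z)
        \<longrightarrow> (SUP z\<in>X \<times> A. \<bar>Qs z - qs z\<bar>) \<le> LQ / (1 - \<gamma>) * xi dmix \<alpha> \<sigma> M (X \<times> A)) \<and>
     (\<forall>(p::'y \<times> nat \<Rightarrow> real) (v::real) (\<sigma>v::real).
        p \<in> borel_measurable (restrict_space (lborel \<Otimes>\<^sub>M count_space UNIV) (X \<times> A)) \<and>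
        (\<forall>u\<in>X \<times> A. 0 \<le> p u) \<and>
        M = density (restrict_space (lborel \<Otimes>\<^sub>M count_space UNIV) (X \<times> A)) (\<lambda>u. ennreal (p u)) \<and>
        0 < essinf (restrict_space (lborel \<Otimes>\<^sub>M count_space UNIV) (X \<times> A)) (\<lambda>u. ereal (p u)) \<and>
        esssup (restrict_space (lborel \<Otimes>\<^sub>M count_space UNIV) (X \<times> A)) (\<lambda>u. ereal (p u)) < \<infinity> \<and>
        0 < v \<and> v \<le> 1 \<and> 0 < \<sigma>v \<and>
        (\<forall>x\<in>X. \<forall>\<rho>. 0 < \<rho> \<and> \<rho> \<le> \<sigma>v * sqrt (real DIM('y)) \<longrightarrow>
           emeasure lborel {y\<in>X. dist x y \<le> \<rho>} \<ge> ennreal (v * ball_vol DIM('y) \<rho>))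
        \<longrightarrow>
        (\<forall>\<sigma>. 0 < \<sigma> \<and> \<sigma> \<le> \<sigma>v \<longrightarrow>
           xi dmix \<alpha> \<sigma> M (X \<times> A)
             \<le> 2 / v * (real_of_ereal (esssup (restrict_space (lborel \<Otimes>\<^sub>M count_space UNIV) (X \<times> A)) (\<lambda>u. ereal (p u)))
                        / real_of_ereal (essinf (restrict_space (lborel \<Otimes>\<^sub>M count_space UNIV) (X \<times> A)) (\<lambda>u. ereal (p u))))
               * (real DIM('y) powr (\<alpha> / 2) * \<sigma> powr \<alpha>
                  + (real (card A) - 1) * (diameter X + 1) powr \<alpha> * exp (- 1 / (2 * \<sigma>\<^sup>2))))))"
proof (intro conjI allI impI, goal_cases)
  \<comment> \<open>Goals 1 and 2 are the error bound and the rate for a compact Euclidean action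
    set; goals 3 and 4 are the same for finitely many actions.\<close>
  case (1 \<gamma> X A W \<psi> f r M Qs \<alpha> LQ \<sigma> qs)
  interpret bellman_model \<gamma> X A W \<psi> f r
    using 1(1) by (intro bellman_model.intro) blast+
  have sets_M: "sets M = sets (restrict_space borel (X \<times> A))"
    using 1(1) by (simp add: restrict_space_sets_cong[OF refl sets_lborel])
  show ?case
  proof (rule smoothed_fixed_point_error[OF _ sets_M, where C = "diameter (X \<times> A)"])
    show "dist z \<in> borel_measurable M" for z
      unfolding measurable_cong_sets[OF sets_M refl] by (intro measurable_restrict_space1) measurable
    show "0 \<le> dist z u" for z u :: "'x \<times> 'a"
      by simp
    show "dist z u \<le> diameter (X \<times> A)" if "z \<in> X \<times> A" "u \<in> X \<times> A" for z u
      using that X A by (intro diameter_bounded_bound compact_imp_bounded compact_Times)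
  qed (use 1 in blast)+
next
  case (2 \<gamma> X A W \<psi> f r M Qs \<alpha> LQ p v \<sigma>v \<sigma>)
  have "xi dist \<alpha> \<sigma> M (X \<times> A)
    \<le> 2 / v * (real_of_ereal (esssup (restrict_space lborel (X \<times> A)) (\<lambda>u. ereal (p u)))
        / real_of_ereal (essinf (restrict_space lborel (X \<times> A)) (\<lambda>u. ereal (p u))))
      * (real DIM('x \<times> 'a) powr (\<alpha> / 2) * \<sigma> powr \<alpha>)"
  proof (rule xi_dist_le)
    show "compact (X \<times> A)" using 2(1) by (intro compact_Times) auto
    fix z \<rho> assume z: "z \<in> X \<times> A" and \<rho>: "0 < \<rho>" "\<rho> \<le> \<sigma> * sqrt (real DIM('x \<times> 'a))"
    \<comment> \<open>The condition \<open>\<sigma> \<le> \<sigma>v\<close> places every radius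
      required by \<open>xi_dist_le\<close> in the range of the volume assumption.\<close>
    have "\<sigma> * sqrt (real DIM('x \<times> 'a)) \<le> \<sigma>v * sqrt (real (DIM('x) + DIM('a)))"
      using 2(3) by (auto intro!: mult_right_mono)
    with \<rho> have "\<rho> \<le> \<sigma>v * sqrt (real (DIM('x) + DIM('a)))" by linarith
    then show "ennreal (v * ball_vol DIM('x \<times> 'a) \<rho>) \<le> emeasure lborel {u \<in> X \<times> A. dist z u \<le> \<rho>}"
      using 2(2) z \<rho>(1) unfolding DIM_prod by blast
  qed (use 2 in blast)+
  then show ?case by (simp only: DIM_prod mult.assoc)
next
  case (3 \<gamma> X A W \<psi> f r M Qs \<alpha> LQ \<sigma> qs)
  interpret bellman_model \<gamma> X A W \<psi> f r
    using 3(1) by (intro bellman_model.intro) (blast intro: finite_imp_compact)+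
  have sets_M: "sets M = sets (restrict_space borel (X \<times> A))"
    using 3(1) by (simp add: restrict_space_sets_cong[OF refl sets_lborel_times_nat])
  show ?case
  proof (rule smoothed_fixed_point_error[OF _ sets_M, where C = "diameter X + 1"])
    have "dmix z \<in> borel_measurable borel" for z :: "'y \<times> nat"
      using measurable_dmix[of z] unfolding measurable_cong_sets[OF sets_lborel_times_nat refl] .
    then show "dmix z \<in> borel_measurable M" for z
      unfolding measurable_cong_sets[OF sets_M refl] by (rule measurable_restrict_space1)
    show "dmix z u \<le> diameter X + 1" if "z \<in> X \<times> A" "u \<in> X \<times> A" for z u
      using that X dmix_le[of z u] diameter_bounded_bound[OF compact_imp_bounded, of X "fst z" "fst u"] by auto
    show "0 \<le> dmix z u" for z u :: "'y \<times> nat"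
      by (simp add: dmix_def)
  qed (use 3 in blast)+
next
  case (4 \<gamma> X A W \<psi> f r M Qs \<alpha> LQ p v \<sigma>v \<sigma>)
  show ?case
  proof (rule xi_dmix_le)
    fix x \<rho> assume x: "x \<in> X" and \<rho>: "0 < \<rho>" "\<rho> \<le> \<sigma> * sqrt (real DIM('y))"
    have "\<sigma> * sqrt (real DIM('y)) \<le> \<sigma>v * sqrt (real DIM('y))"
      using 4(3) by (auto intro!: mult_right_mono)
    with \<rho> have "\<rho> \<le> \<sigma>v * sqrt (real DIM('y))" by linarith
    then show "ennreal (v * ball_vol DIM('y) \<rho>) \<le> emeasure lborel {y \<in> X. dist x y \<le> \<rho>}"
      using 4(2) x \<rho>(1) by blast
  qed (use 4 in blast)+
qed

end
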